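(* Consider the no-show model described in the context, with $\epsilon>0$ and data $\widehat{\boldsymbol\xi}^j=(\widehat{\boldsymbol\mu}^j,\widehat{\boldsymbol\lambda}^j)\in\Xi$, $j\in[N]$. (i) If $p=1$, then W-NS has the same optimal value and the same optimal solutions $\mathbf s$ as the copositive program $$\widehat Z_{NS}(N,\epsilon)=\inf\ \epsilon\rho+\frac1N\sum_{j=1}^N\beta_j$$ over $\rho\in\mathbb R$, $\boldsymbol\beta\in\mathbb R^N$, $\boldsymbol\psi,\boldsymbol\phi\in\mathbb R^{n\times N}$, $\mathbf s$, subject to $\beta_j\mathbf e_1\mathbf e_1^\top+\sum_{i=1}^n\psi_{ij}\mathbf M_i+\sum_{i=1}^n\phi_{ij}\mathbf J_i-\mathbf G^1_j(\rho,\mathbf s)\in\mathcal{COP}(\mathcal K^j_{NS,1})$ for all $j\in[N]$, $\rho\ge0$, $\mathbf s\in\mathcal S$ (here $\mathbf e_1\in\mathbb R^{5n+1}$). (ii) If $p=2$, then W-NS has the same optimal value and the same optimal solutions $\mathbf s$ as the copositive program $$\widehat Z_{NS}(N,\epsilon)=\inf\ \epsilon^2\rho+\frac1N\sum_{j=1}^N\beta_j$$ over $\rho\in\mathbb R$, $\boldsymbol\beta\in\mathbb R^N$, $\boldsymbol\psi\in\mathbb R^{n\times N}$, $\mathbf s$, subject to $\beta_j\mathbf e_1\mathbf e_1^\top+\sum_{i=1}^n\psi_{ij}\mathbf N_i-\mathbf G^2_j(\rho,\mathbf s)\in\mathcal{COP}(\mathcal K_{NS,2})$ for all $j\in[N]$,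 $\rho\ge0$, $\mathbf s\in\mathcal S$ (here $\mathbf e_1\in\mathbb R^{3n+1}$).
   Context: Notation: $[m]=\{1,\dots,m\}$, $[i,j]_{\mathbb Z}=\{i,\dots,j\}$, $\mathbf e$ all-ones vector, $\mathbf e_i$ $i$-th standard basis vector, $\mathbf I$ identity, $\mathbb S^k$ symmetric $k\times k$ matrices. Data: $n,N\ge1$, $T>0$, $\mathcal S=\{\mathbf s\in\mathbb R^n:\mathbf s\ge0,\sum_is_i\le T\}$, costs $\mathbf c,\mathbf d\in\mathbb R^n_+$, $C\ge0$ with $d_{i+1}-d_i\le c_{i+1}$ ($i\in[n-1]$), bounds $0\le u^L_i<u^U_i<\infty$, an integer $K\in[n]$. $\Lambda=\{\boldsymbol\lambda\in\{0,1\}^n:\sum_i(1-\lambda_i)\le K\}$, $\Xi=\{(\boldsymbol\mu,\boldsymbol\lambda)\in\mathbb R^n\times\Lambda:u^L_i\lambda_i\le\mu_i\le u^U_i\lambda_i\ \forall i\}$. For $\boldsymbol\xi=(\boldsymbol\mu,\boldsymbol\lambda)\in\Xi$, $g(\mathbf s,\boldsymbol\xi)$ is the optimal value of $\min_{\mathbf w\in\mathbb R^{n+1},\mathbf v\in\mathbb R^n}\sum_{i=1}^n(c_i\lambda_iw_i+d_iv_i)+Cw_{n+1}$ s.t. $w_i-v_{i-1}=\mu_{i-1}+w_{i-1}-s_{i-1}$ ($i\in[2,n+1]_{\mathbb Z}$), $\mathbf w\ge0,w_1=0,\mathbf v\ge0$. For $p\ge1$, $d_p$ is the $p$-Wasserstein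 distance on distributions over $\Xi\subseteq\mathbb R^{2n}$ with cost $\|\cdot\|_p^p$ (i.e. $d_p(\mathbb Q_1,\mathbb Q_2)=(\inf_\Pi\mathbb E_\Pi\|\boldsymbol\xi_1-\boldsymbol\xi_2\|_p^p)^{1/p}$ over couplings); $\widehat{\mathbb P}^N=\frac1N\sum_j\delta_{\widehat{\boldsymbol\xi}^j}$; $\mathcal D_p(\widehat{\mathbb P}^N,\epsilon)$ is the set of distributions $\mathbb Q$ on $\Xi$ with $d_p(\mathbb Q,\widehat{\mathbb P}^N)\le\epsilon$; W-NS is $\widehat Z_{NS}(N,\epsilon)=\min_{\mathbf s\in\mathcal S}\sup_{\mathbb Q\in\mathcal D_p}\mathbb E_{\mathbb Q}[g(\mathbf s,\boldsymbol\xi)]$. For $\boldsymbol\lambda\in\mathbb R^n$, $\mathcal Y(\boldsymbol\lambda)=\{\mathbf y\in\mathbb R^n:-y_i\le d_i\ \forall i;\ y_{i-1}-y_i\le c_i\lambda_i\ \forall i\in[2,n]_{\mathbb Z};\ y_n\le C\}$. $\mathcal F^j_{NS,1}$ is the set of $(\boldsymbol\mu^+,\boldsymbol\mu^-,\boldsymbol\lambda^+,\boldsymbol\lambda^-,\mathbf y)\in\mathbb R^{5n}$ with $\boldsymbol\mu^\pm,\boldsymbol\lambda^\pm\ge0$, $0\le\boldsymbol\lambda^+-\boldsymbol\lambda^-+\widehat{\boldsymbol\lambda}^j\le\mathbf e$, $\boldsymbol\lambda^+\le\mathbf e$, $\boldsymbol\lambda^-\le\mathbf e$, $\sum_i[1-(\lambda^+_i-\lambda^-_i+\widehat\lambda^j_i)]\le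 K$, $u^L_i(\lambda^+_i-\lambda^-_i+\widehat\lambda^j_i)\le\mu^+_i-\mu^-_i+\widehat\mu^j_i\le u^U_i(\lambda^+_i-\lambda^-_i+\widehat\lambda^j_i)$ for all $i$, $y_n\le C$, $-y_i\le d_i$ for all $i$, $y_{i-1}-y_i\le c_i(\lambda^+_i-\lambda^-_i+\widehat\lambda^j_i)$ for $i\in[2,n]_{\mathbb Z}$. $\mathcal F_{NS,2}$ is the set of $(\boldsymbol\mu,\boldsymbol\lambda,\mathbf y)\in\mathbb R^{3n}$ with $\mathbf y\in\mathcal Y(\boldsymbol\lambda)$, $\sum_i(1-\lambda_i)\le K$, $0\le\boldsymbol\lambda\le\mathbf e$, $u^L_i\lambda_i\le\mu_i\le u^U_i\lambda_i$ for all $i$. Perspective cones: $\mathcal K^j_{NS,1}=\mathrm{closure}\{(t,\mathbf x):\mathbf x/t\in\mathcal F^j_{NS,1},t>0\}\subseteq\mathbb R^{5n+1}$, $\mathcal K_{NS,2}=\mathrm{closure}\{(t,\mathbf x):\mathbf x/t\in\mathcal F_{NS,2},t>0\}\subseteq\mathbb R^{3n+1}$. For a closed convex cone $\mathcal K\subseteq\mathbb R^k$, $\mathcal{COP}(\mathcal K)=\{\mathbf M\in\mathbb S^k:\mathbf x^\top\mathbf M\mathbf x\ge0\ \forall\mathbf x\in\mathcal K\}$. Matrices in $\mathbb S^{5n+1}$ with blocks of sizes $(1,n,n,n,n,n)$ corresponding to $(t,\boldsymbol\mu^+,\boldsymbol\mu^-,\boldsymbol\lambda^+,\boldsymbol\lambda^-,\mathbf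 y)$: $\mathbf G^1_j(\rho,\mathbf s)$ has first row $(0,-\tfrac12\rho\mathbf e^\top,-\tfrac12\rho\mathbf e^\top,-\tfrac12\rho\mathbf e^\top,-\tfrac12\rho\mathbf e^\top,\tfrac12(\widehat{\boldsymbol\mu}^j-\mathbf s)^\top)$ and the symmetric first column, the $(\boldsymbol\mu^+,\mathbf y)$ and $(\mathbf y,\boldsymbol\mu^+)$ blocks equal $\tfrac12\mathbf I$, the $(\boldsymbol\mu^-,\mathbf y)$ and $(\mathbf y,\boldsymbol\mu^-)$ blocks equal $-\tfrac12\mathbf I$, and all other blocks zero. With $\mathbf a_i\in\mathbb R^{5n+1}$ having $\mathbf e_i$ in the $\boldsymbol\lambda^+$ block and zeros elsewhere, $\mathbf b_i$ having $\mathbf e_i$ in the $\boldsymbol\lambda^-$ block, and $\mathbf e_1$ the first basis vector: $\mathbf J_i=\mathbf a_i\mathbf a_i^\top-\tfrac12\mathbf a_i\mathbf e_1^\top-\tfrac12\mathbf e_1\mathbf a_i^\top$, $\mathbf M_i=\mathbf b_i\mathbf b_i^\top-\tfrac12\mathbf b_i\mathbf e_1^\top-\tfrac12\mathbf e_1\mathbf b_i^\top$. Matrices in $\mathbb S^{3n+1}$ with blocks $(1,n,n,n)$ corresponding to $(t,\boldsymbol\mu,\boldsymbol\lambda,\mathbf y)$: $$\mathbf G^2_j(\rho,\mathbf s)=\begin{bmatrix}-\rho(\|\widehat{\boldsymbol\mu}^j\|_2^2+\|\widehat{\boldsymbol\lambda}^j\|_2^2)&\rho(\widehat{\boldsymbol\mu}^j)^\top&\rho(\widehat{\boldsymbol\lambda}^j)^\top&-\tfrac12\mathbf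 s^\top\\\rho\widehat{\boldsymbol\mu}^j&-\rho\mathbf I&0&\tfrac12\mathbf I\\\rho\widehat{\boldsymbol\lambda}^j&0&-\rho\mathbf I&0\\-\tfrac12\mathbf s&\tfrac12\mathbf I&0&0\end{bmatrix},$$ and with $\mathbf c_i\in\mathbb R^{3n+1}$ having $\mathbf e_i$ in the $\boldsymbol\lambda$ block, $\mathbf N_i=\mathbf c_i\mathbf c_i^\top-\tfrac12\mathbf c_i\mathbf e_1^\top-\tfrac12\mathbf e_1\mathbf c_i^\top$. *)

theory Defs
  imports "HOL-Probability.Probability"
begin

text \<open>Conventions. All vectors are functions nat \<Rightarrow> real, indexed 1-based as in the paper;
  a vector of R^k is a function vanishing outside {1..k}. Matrices in S^k are functions
  nat \<Rightarrow> nat \<Rightarrow> real, only the entries with indices in {1..k} matter.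
  A scenario xi = (mu, lambda) is a pair of vectors of R^n.\<close>

type_synonym vec = "nat \<Rightarrow> real"
type_synonym mat = "nat \<Rightarrow> nat \<Rightarrow> real"
type_synonym scen = "vec \<times> vec"

definition vecs :: "nat \<Rightarrow> vec set" where
  "vecs k = {x. \<forall>i. i \<notin> {1..k} \<longrightarrow> x i = 0}"

definition Lam :: "nat \<Rightarrow> nat \<Rightarrow> vec set" where
  "Lam n K = {l \<in> vecs n. (\<forall>i\<in>{1..n}. l i = 0 \<or> l i = 1) \<and> (\<Sum>i=1..n. 1 - l i) \<le> real K}"

definition Xi :: "nat \<Rightarrow> nat \<Rightarrow> vec \<Rightarrow> vec \<Rightarrow> scen set" where
  "Xi n K uL uU = {(m, l). l \<in> Lam n K \<and> m \<in> vecs n \<and>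
      (\<forall>i\<in>{1..n}. uL i * l i \<le> m i \<and> m i \<le> uU i * l i)}"

definition Sset :: "nat \<Rightarrow> real \<Rightarrow> vec set" where
  "Sset n T = {s \<in> vecs n. (\<forall>i\<in>{1..n}. 0 \<le> s i) \<and> (\<Sum>i=1..n. s i) \<le> T}"

definition gval :: "nat \<Rightarrow> vec \<Rightarrow> vec \<Rightarrow> real \<Rightarrow> vec \<Rightarrow> scen \<Rightarrow> real" where
  "gval n c d C s xi = (case xi of (m, l) \<Rightarrow>
     Inf {(\<Sum>i=1..n. c i * l i * w i + d i * v i) + C * w (n+1) | w v.
            (\<forall>i\<in>{2..n+1}. w i - v (i-1) = m (i-1) + w (i-1) - s (i-1)) \<and>
            (\<forall>i\<in>{1..n+1}. 0 \<le> w i) \<and> w 1 = 0 \<and> (\<forall>i\<in>{1..n}. 0 \<le> v i)})"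

definition costp :: "nat \<Rightarrow> nat \<Rightarrow> scen \<Rightarrow> scen \<Rightarrow> real" where
  "costp n p x y = (\<Sum>i=1..n. \<bar>fst x i - fst y i\<bar> ^ p + \<bar>snd x i - snd y i\<bar> ^ p)"

definition couplings :: "scen measure \<Rightarrow> scen measure \<Rightarrow> (scen \<times> scen) measure set" where
  "couplings Q1 Q2 = {P. prob_space P \<and> sets P = sets borel \<and>
      (\<forall>A\<in>sets borel. emeasure P (A \<times> UNIV) = emeasure Q1 A \<and>
                      emeasure P (UNIV \<times> A) = emeasure Q2 A)}"

definition wass_dist :: "nat \<Rightarrow> nat \<Rightarrow> scen measure \<Rightarrow> scen measure \<Rightarrow> ereal" where
  "wass_dist n p Q1 Q2 =
     (let W = (INF P\<in>couplings Q1 Q2. \<integral>\<^sup>+ z. ennreal (costp n p (fst z) (snd z)) \<partial>P)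
      in if W = \<top> then \<infinity> else ereal (enn2real W powr (1 / real p)))"

definition emp_dist :: "nat \<Rightarrow> (nat \<Rightarrow> vec) \<Rightarrow> (nat \<Rightarrow> vec) \<Rightarrow> scen measure" where
  "emp_dist N muh lamh = measure_pmf (map_pmf (\<lambda>j. (muh j, lamh j)) (pmf_of_set {1..N}))"

definition distributions_on :: "scen set \<Rightarrow> scen measure set" where
  "distributions_on S = {Q. prob_space Q \<and> sets Q = sets borel \<and> (AE x in Q. x \<in> S)}"

definition amb :: "nat \<Rightarrow> nat \<Rightarrow> vec \<Rightarrow> vec \<Rightarrow> nat \<Rightarrow> nat \<Rightarrow> (nat \<Rightarrow> vec) \<Rightarrow> (nat \<Rightarrow> vec)
                     \<Rightarrow> real \<Rightarrow> scen measure set" where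
  "amb n K uL uU p N muh lamh \<epsilon> =
     {Q \<in> distributions_on (Xi n K uL uU). wass_dist n p Q (emp_dist N muh lamh) \<le> ereal \<epsilon>}"

definition wns_obj where
  "wns_obj n T c d C uL uU K p N muh lamh \<epsilon> s =
     (SUP Q\<in>amb n K uL uU p N muh lamh \<epsilon>. ereal (\<integral>xi. gval n c d C s xi \<partial>Q))"

definition Z_wns where
  "Z_wns n T c d C uL uU K p N muh lamh \<epsilon> =
     (INF s\<in>Sset n T. wns_obj n T c d C uL uU K p N muh lamh \<epsilon> s)"

definition wns_opt where
  "wns_opt n T c d C uL uU K p N muh lamh \<epsilon> =
     {s \<in> Sset n T. wns_obj n T c d C uL uU K p N muh lamh \<epsilon> s = Z_wns n T c d C uL uU K p N muh lamh \<epsilon>}"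

definition qform :: "nat \<Rightarrow> mat \<Rightarrow> vec \<Rightarrow> real" where
  "qform k M x = (\<Sum>a=1..k. \<Sum>b=1..k. x a * M a b * x b)"

definition COP :: "nat \<Rightarrow> vec set \<Rightarrow> mat set" where
  "COP k KK = {M. (\<forall>a\<in>{1..k}. \<forall>b\<in>{1..k}. M a b = M b a) \<and> (\<forall>x\<in>KK. 0 \<le> qform k M x)}"

definition basis :: "nat \<Rightarrow> vec" where
  "basis k = (\<lambda>i. if i = k then 1 else 0)"

definition outer :: "vec \<Rightarrow> vec \<Rightarrow> mat" where
  "outer x y = (\<lambda>a b. x a * y b)"

definition ent :: "nat \<Rightarrow> nat \<Rightarrow> real \<Rightarrow> mat" where
  "ent a b v = (\<lambda>r q. if (r = a \<and> q = b) \<or> (r = b \<and> q = a) then v else 0)"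

definition persp :: "nat \<Rightarrow> vec set \<Rightarrow> vec set" where
  "persp k F = closure {x \<in> vecs k. 0 < x 1 \<and>
       (\<lambda>i. if i \<in> {1..k-1} then x (i+1) / x 1 else 0) \<in> F}"

text \<open>b-th block (0-based) of length n of a vector, as a vector of R^n\<close>
definition blk :: "nat \<Rightarrow> nat \<Rightarrow> vec \<Rightarrow> vec" where
  "blk n b z = (\<lambda>i. if i \<in> {1..n} then z (b * n + i) else 0)"

definition Ycal :: "nat \<Rightarrow> vec \<Rightarrow> vec \<Rightarrow> real \<Rightarrow> vec \<Rightarrow> vec set" where
  "Ycal n c d C l = {y \<in> vecs n. (\<forall>i\<in>{1..n}. - y i \<le> d i) \<and>
       (\<forall>i\<in>{2..n}. y (i-1) - y i \<le> c i * l i) \<and> y n \<le> C}"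

definition F1 :: "nat \<Rightarrow> nat \<Rightarrow> vec \<Rightarrow> vec \<Rightarrow> real \<Rightarrow> vec \<Rightarrow> vec \<Rightarrow> vec \<Rightarrow> vec \<Rightarrow> vec set" where
  "F1 n K uL uU C c d muhj lamhj = {z \<in> vecs (5*n).
     (let mp = blk n 0 z; mm = blk n 1 z; lp = blk n 2 z; lm = blk n 3 z; y = blk n 4 z;
          lam = (\<lambda>i. lp i - lm i + lamhj i); mu = (\<lambda>i. mp i - mm i + muhj i) in
      (\<forall>i\<in>{1..n}. 0 \<le> mp i \<and> 0 \<le> mm i \<and> 0 \<le> lp i \<and> 0 \<le> lm i \<and>
                   0 \<le> lam i \<and> lam i \<le> 1 \<and> lp i \<le> 1 \<and> lm i \<le> 1 \<and>
                   uL i * lam i \<le> mu i \<and> mu i \<le> uU i * lam i \<and> - y i \<le> d i) \<and>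
      (\<Sum>i=1..n. 1 - lam i) \<le> real K \<and> y n \<le> C \<and>
      (\<forall>i\<in>{2..n}. y (i-1) - y i \<le> c i * lam i))}"

definition F2 :: "nat \<Rightarrow> nat \<Rightarrow> vec \<Rightarrow> vec \<Rightarrow> real \<Rightarrow> vec \<Rightarrow> vec \<Rightarrow> vec set" where
  "F2 n K uL uU C c d = {z \<in> vecs (3*n).
     (let mu = blk n 0 z; l = blk n 1 z; y = blk n 2 z in
      y \<in> Ycal n c d C l \<and> (\<Sum>i=1..n. 1 - l i) \<le> real K \<and>
      (\<forall>i\<in>{1..n}. 0 \<le> l i \<and> l i \<le> 1 \<and> uL i * l i \<le> mu i \<and> mu i \<le> uU i * l i))}"

definition K1 where
  "K1 n K uL uU C c d muhj lamhj = persp (5*n+1) (F1 n K uL uU C c d muhj lamhj)"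

definition K2 where
  "K2 n K uL uU C c d = persp (3*n+1) (F2 n K uL uU C c d)"

text \<open>Index layout in R^(5n+1): t = 1, mu+ at 1+i, mu- at 1+n+i, lambda+ at 1+2n+i,
  lambda- at 1+3n+i, y at 1+4n+i (i = 1..n).\<close>
definition G1 :: "nat \<Rightarrow> vec \<Rightarrow> real \<Rightarrow> vec \<Rightarrow> mat" where
  "G1 n muhj \<rho> s = (\<lambda>r q. \<Sum>i=1..n.
       ent 1 (1+i) (-\<rho>/2) r q + ent 1 (1+n+i) (-\<rho>/2) r q
     + ent 1 (1+2*n+i) (-\<rho>/2) r q + ent 1 (1+3*n+i) (-\<rho>/2) r q
     + ent 1 (1+4*n+i) ((muhj i - s i) / 2) r q
     + ent (1+i) (1+4*n+i) (1/2) r q + ent (1+n+i) (1+4*n+i) (-1/2) r q)"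

definition Jm :: "nat \<Rightarrow> nat \<Rightarrow> mat" where
  "Jm n i = (let a = basis (1+2*n+i); e1 = basis 1 in
     (\<lambda>r q. outer a a r q - 1/2 * outer a e1 r q - 1/2 * outer e1 a r q))"

definition Mm :: "nat \<Rightarrow> nat \<Rightarrow> mat" where
  "Mm n i = (let b = basis (1+3*n+i); e1 = basis 1 in
     (\<lambda>r q. outer b b r q - 1/2 * outer b e1 r q - 1/2 * outer e1 b r q))"

text \<open>Index layout in R^(3n+1): t = 1, mu at 1+i, lambda at 1+n+i, y at 1+2n+i.\<close>
definition G2 :: "nat \<Rightarrow> vec \<Rightarrow> vec \<Rightarrow> real \<Rightarrow> vec \<Rightarrow> mat" where
  "G2 n muhj lamhj \<rho> s = (\<lambda>r q.
       ent 1 1 (- \<rho> * ((\<Sum>i=1..n. (muhj i)^2) + (\<Sum>i=1..n. (lamhj i)^2))) r q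
     + (\<Sum>i=1..n. ent 1 (1+i) (\<rho> * muhj i) r q + ent 1 (1+n+i) (\<rho> * lamhj i) r q
         + ent 1 (1+2*n+i) (- s i / 2) r q
         + ent (1+i) (1+i) (-\<rho>) r q + ent (1+n+i) (1+n+i) (-\<rho>) r q
         + ent (1+i) (1+2*n+i) (1/2) r q))"

definition Nm :: "nat \<Rightarrow> nat \<Rightarrow> mat" where
  "Nm n i = (let cc = basis (1+n+i); e1 = basis 1 in
     (\<lambda>r q. outer cc cc r q - 1/2 * outer cc e1 r q - 1/2 * outer e1 cc r q))"

definition cop1_feas where
  "cop1_feas n T c d C uL uU K N muh lamh \<rho> \<beta> \<psi> \<phi> s \<longleftrightarrow>
     0 \<le> \<rho> \<and> s \<in> Sset n T \<and>
     (\<forall>j\<in>{1..N}. (\<lambda>r q. \<beta> j * outer (basis 1) (basis 1) r q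
          + (\<Sum>i=1..n. \<psi> i j * Mm n i r q) + (\<Sum>i=1..n. \<phi> i j * Jm n i r q)
          - G1 n (muh j) \<rho> s r q)
        \<in> COP (5*n+1) (K1 n K uL uU C c d (muh j) (lamh j)))"

definition cop1_obj :: "nat \<Rightarrow> real \<Rightarrow> real \<Rightarrow> (nat \<Rightarrow> real) \<Rightarrow> real" where
  "cop1_obj N \<epsilon> \<rho> \<beta> = \<epsilon> * \<rho> + (1 / real N) * (\<Sum>j=1..N. \<beta> j)"

definition Z_cop1 where
  "Z_cop1 n T c d C uL uU K N muh lamh \<epsilon> =
     Inf {ereal (cop1_obj N \<epsilon> \<rho> \<beta>) | \<rho> \<beta> \<psi> \<phi> s. cop1_feas n T c d C uL uU K N muh lamh \<rho> \<beta> \<psi> \<phi> s}"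

definition cop1_opt where
  "cop1_opt n T c d C uL uU K N muh lamh \<epsilon> =
     {s. \<exists>\<rho> \<beta> \<psi> \<phi>. cop1_feas n T c d C uL uU K N muh lamh \<rho> \<beta> \<psi> \<phi> s \<and>
          ereal (cop1_obj N \<epsilon> \<rho> \<beta>) = Z_cop1 n T c d C uL uU K N muh lamh \<epsilon>}"

definition cop2_feas where
  "cop2_feas n T c d C uL uU K N muh lamh \<rho> \<beta> \<psi> s \<longleftrightarrow>
     0 \<le> \<rho> \<and> s \<in> Sset n T \<and>
     (\<forall>j\<in>{1..N}. (\<lambda>r q. \<beta> j * outer (basis 1) (basis 1) r q
          + (\<Sum>i=1..n. \<psi> i j * Nm n i r q)
          - G2 n (muh j) (lamh j) \<rho> s r q)
        \<in> COP (3*n+1) (K2 n K uL uU C c d))"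

definition cop2_obj :: "nat \<Rightarrow> real \<Rightarrow> real \<Rightarrow> (nat \<Rightarrow> real) \<Rightarrow> real" where
  "cop2_obj N \<epsilon> \<rho> \<beta> = \<epsilon>\<^sup>2 * \<rho> + (1 / real N) * (\<Sum>j=1..N. \<beta> j)"

definition Z_cop2 where
  "Z_cop2 n T c d C uL uU K N muh lamh \<epsilon> =
     Inf {ereal (cop2_obj N \<epsilon> \<rho> \<beta>) | \<rho> \<beta> \<psi> s. cop2_feas n T c d C uL uU K N muh lamh \<rho> \<beta> \<psi> s}"

definition cop2_opt where
  "cop2_opt n T c d C uL uU K N muh lamh \<epsilon> =
     {s. \<exists>\<rho> \<beta> \<psi>. cop2_feas n T c d C uL uU K N muh lamh \<rho> \<beta> \<psi> s \<and>
          ereal (cop2_obj N \<epsilon> \<rho> \<beta>) = Z_cop2 n T c d C uL uU K N muh lamh \<epsilon>}"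

end

theory Submission
  imports Defs
begin

text \<open>Fix \<open>s\<close>. The worst-case expectation is bounded by the Lagrangian dual
  \<open>\<epsilon>\<^sup>p \<rho> + 1/N \<Sum>j sup (g - \<rho> cost)\<close>, and since the zero-cost plan is strictly feasible, a
  multiplier \<open>\<rho>\<close> attaining equality exists; it is separated off using only mixtures of two plans
  that move each data point to a single scenario. Linear programming duality writes \<open>g\<close> as the
  maximum of \<open>(\<mu> - s) \<bullet> y\<close> over \<open>y \<in> \<Y>(\<lambda>)\<close>, so each inner supremum is a
  mixed-binary quadratic program. Its relaxation to \<open>\<lambda> \<in> [0,1]\<^sup>n\<close> has feasible sets that are
  Lipschitz in \<open>\<lambda>\<close>, hence a finite multiple of \<open>\<Sum>i \<lambda>\<^sub>i (1 - \<lambda>\<^sub>i)\<close> is an exact penalty for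
  integrality. This penalty is precisely the choice of \<open>\<psi>, \<phi>\<close> as large negative constants, so
  the copositive program attains the dual value for every \<open>s\<close>, and the optimal values and
  solutions agree.\<close>

section \<open>Linear programming duality for the second stage\<close>

text \<open>Equality of the two infima would not yet transfer minimisers: a copositive infimum that
  is only approached at some \<open>s\<close> would lose that \<open>s\<close> from the solution
  set. Hence a multiplier \<rho> is needed that attains the dual value, and the penalty must be
  exact at a finite constant instead of in a limit. Mixtures of two plans are enough for \<rho>
  because there is one budget constraint: a plan above the budget and a plan below it are mixed so
  that the budget is met exactly. The delicate Lipschitz estimate is the one for \<open>y\<close>.
  Moving \<open>l\<close> to a binary point tightens some bounds on \<open>y (i-1) - y i\<close>,
  and a repair at one index propagates along the whole chain. For p = 1 both the \<lambda>+ and the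
  \<lambda>- part may be positive and fractional, so integrality is penalised on each part although
  the scenario only sees their difference. They are rounded separately, and the bounds 0 and 1 on
  the resulting no-show vector keep the rounded difference binary.\<close>

definition sublin :: "(vec \<Rightarrow> real) \<Rightarrow> bool" where
  "sublin p \<longleftrightarrow> (\<forall>x y. p (\<lambda>i. x i + y i) \<le> p x + p y) \<and>
     (\<forall>x t. 0 \<le> t \<longrightarrow> p (\<lambda>i. t * x i) = t * p x)"

text \<open>One inequality suffices for homogeneity: applied with factor \<open>1 / t\<close> to the
  vector \<open>t * x\<close> it yields the reverse one.\<close>

lemma sublinI:
  assumes "\<And>x y. p (\<lambda>i. x i + y i) \<le> p x + p y"
    and "\<And>x t. 0 < t \<Longrightarrow> p (\<lambda>i. t * x i) \<le> t * p x" and "p (\<lambda>_. 0) = 0"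
  shows "sublin p"
proof -
  have "p (\<lambda>i. t * x i) = t * p x" if "0 \<le> t" for x t
  proof (cases "t = 0")
    case True
    then show ?thesis using assms(3) by simp
  next
    case False
    with that have t: "0 < t" by simp
    have "p (\<lambda>i. (1 / t) * (t * x i)) \<le> 1 / t * p (\<lambda>i. t * x i)"
      using assms(2)[of "1 / t" "\<lambda>i. t * x i"] t by simp
    moreover have "(\<lambda>i. (1 / t) * (t * x i)) = x" using t by auto
    ultimately have "t * p x \<le> p (\<lambda>i. t * x i)" using t by (simp add: field_simps)
    with assms(2)[OF t, of x] show ?thesis by simp
  qed
  then show ?thesis unfolding sublin_def using assms(1) by blast
qed

lemma sublin_add: "sublin p \<Longrightarrow> p (\<lambda>i. x i + y i) \<le> p x + p y"
  unfolding sublin_def by blast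

lemma sublin_scale: "sublin p \<Longrightarrow> 0 \<le> t \<Longrightarrow> p (\<lambda>i. t * x i) = t * p x"
  unfolding sublin_def by blast

lemma sublin_zero: "sublin p \<Longrightarrow> p (\<lambda>_. 0) = 0"
  using sublin_scale[of p 0 "\<lambda>_. 0"] by simp

lemma sublin_neg: "sublin p \<Longrightarrow> 0 \<le> p x + p (\<lambda>i. - x i)"
  using sublin_add[of p x "\<lambda>i. - x i"] sublin_zero[of p] by simp

text \<open>One Hahn-Banach step. The infimum of \<open>p (x + t * b) - t * p b\<close> over t \<ge>
  0 stays sublinear and below \<open>p\<close>; the choice t = 1 at x = - b bounds
  \<open>q (- b)\<close> by \<open>- p b\<close>, and \<open>q b + q (- b)\<close> cannot be
  negative, so \<open>q\<close> is linear on the line through \<open>b\<close>.\<close>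

lemma sublin_linearise:
  assumes p: "sublin p"
  obtains q where "sublin q" "\<And>x. q x \<le> p x" "q b = p b" "q (\<lambda>i. - b i) = - p b"
proof -
  define f where "f x t = p (\<lambda>i. x i + t * b i) - t * p b" for x t
  define q where "q x = (INF t\<in>{0..}. f x t)" for x
  \<comment> \<open>Subadditivity bounds the infimum from below by a number independent of
    \<open>t\<close>, so that \<open>q\<close> is real-valued.\<close>
  have low: "- p (\<lambda>i. - x i) \<le> f x t" if "0 \<le> t" for x t
    using sublin_add[OF p, of "\<lambda>i. x i + t * b i" "\<lambda>i. - x i"] sublin_scale[OF p that, of b]
    by (simp add: f_def)
  have bdd: "bdd_below (f x ` {0..})" for x
    using low by (intro bdd_belowI2[where m="- p (\<lambda>i. - x i)"]) auto
  have q_le: "q x \<le> f x t" if "0 \<le> t" for x t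
    unfolding q_def using that by (intro cINF_lower[OF bdd]) auto
  have q_ge: "m \<le> q x" if "\<And>t. 0 \<le> t \<Longrightarrow> m \<le> f x t" for m x
    unfolding q_def using that by (intro cINF_greatest) auto
  have q_approx: "\<exists>t\<ge>0. f x t < q x + e" if "0 < e" for x e
    using q_ge[of "q x + e" x] that by (metis add_le_same_cancel1 not_le)
  have q_p: "q x \<le> p x" for x using q_le[of 0 x] by (simp add: f_def)
  have "sublin q"
  proof (rule sublinI)
    fix x y
    show "q (\<lambda>i. x i + y i) \<le> q x + q y"
    proof (rule field_le_epsilon)
      fix e :: real assume "0 < e"
      then obtain t u where t: "0 \<le> t" "f x t < q x + e / 2" and u: "0 \<le> u" "f y u < q y + e / 2"
        using q_approx[of "e / 2"] by (meson half_gt_zero)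
      have "f (\<lambda>i. x i + y i) (t + u) \<le> f x t + f y u"
        using sublin_add[OF p, of "\<lambda>i. x i + t * b i" "\<lambda>i. y i + u * b i"]
        by (simp add: f_def algebra_simps)
      with q_le[of "t + u" "\<lambda>i. x i + y i"] t u show "q (\<lambda>i. x i + y i) \<le> q x + q y + e" by simp
    qed
  next
    fix x and t :: real assume t: "0 < t"
    have "q (\<lambda>i. t * x i) / t \<le> q x"
    proof (rule q_ge)
      fix u :: real assume u: "0 \<le> u"
      have "q (\<lambda>i. t * x i) \<le> f (\<lambda>i. t * x i) (t * u)" using q_le t u by simp
      also have "\<dots> = t * f x u"
        using sublin_scale[OF p, of t "\<lambda>i. x i + u * b i"] t by (simp add: f_def algebra_simps)
      finally show "q (\<lambda>i. t * x i) / t \<le> f x u" using t by (simp add: field_simps)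
    qed
    then show "q (\<lambda>i. t * x i) \<le> t * q x" using t by (simp add: field_simps)
  next
    have "0 \<le> q (\<lambda>_. 0)"
      by (rule q_ge) (use sublin_scale[OF p, of _ b] in \<open>simp add: f_def\<close>)
    with q_p[of "\<lambda>_. 0"] sublin_zero[OF p] show "q (\<lambda>_. 0) = 0" by simp
  qed
  moreover have "q (\<lambda>i. - b i) \<le> - p b"
    using q_le[of 1 "\<lambda>i. - b i"] sublin_zero[OF p] by (simp add: f_def)
  moreover note sublin_neg[OF \<open>sublin q\<close>, of b] q_p[of b]
  ultimately have "q b = p b" "q (\<lambda>i. - b i) = - p b" by auto
  with \<open>sublin q\<close> q_p that show ?thesis by blast
qed

text \<open>Hahn--Banach for \<open>\<real>\<^sup>n\<close>: linearise along \<open>b\<close>, then along each coordinate axis.\<close>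
lemma sublin_support:
  fixes n :: nat
  assumes p: "sublin p" and b: "b \<in> vecs n"
  obtains y where "\<And>x. x \<in> vecs n \<Longrightarrow> (\<Sum>i=1..n. y i * x i) \<le> p x" "(\<Sum>i=1..n. y i * b i) = p b"
proof -
  have "\<exists>q. sublin q \<and> (\<forall>x. q x \<le> p x) \<and> q b = p b \<and>
          (\<forall>k\<in>{1..m}. q (\<lambda>i. - basis k i) = - q (basis k))" for m
  proof (induction m)
    case 0
    then show ?case using p by auto
  next
    case (Suc m)
    then obtain q where q: "sublin q" "\<And>x. q x \<le> p x" "q b = p b"
      "\<And>k. k \<in> {1..m} \<Longrightarrow> q (\<lambda>i. - basis k i) = - q (basis k)" by blast
    \<comment> \<open>The invariant does not record the value at \<open>- b\<close>, so each round
      first linearises along \<open>b\<close> again. Then \<open>r b\<close> and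
      \<open>r (- b)\<close> are at most \<open>q b\<close> and \<open>- q b\<close> and have
      nonnegative sum, which fixes \<open>r b\<close>.\<close>
    obtain r0 where r0: "sublin r0" "\<And>x. r0 x \<le> q x" "r0 b = q b" "r0 (\<lambda>i. - b i) = - q b"
      by (rule sublin_linearise[OF q(1), of b]) blast
    obtain r where r: "sublin r" "\<And>x. r x \<le> r0 x"
      "r (basis (Suc m)) = r0 (basis (Suc m))" "r (\<lambda>i. - basis (Suc m) i) = - r0 (basis (Suc m))"
      by (rule sublin_linearise[OF r0(1), of "basis (Suc m)"]) blast
    have "r b = p b"
      using r(2)[of b] r(2)[of "\<lambda>i. - b i"] r0 q(3) sublin_neg[OF r(1), of b] by auto
    moreover have "r (\<lambda>i. - basis k i) = - r (basis k)" if "k \<in> {1..Suc m}" for k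
    proof (cases "k = Suc m")
      case True
      then show ?thesis using r by simp
    next
      case False
      \<comment> \<open>Axes treated earlier stay linear: \<open>r\<close> lies below
        \<open>q\<close>, so its two values on the axis have sum at most 0, while sublinearity makes
        that sum nonnegative.\<close>
      with that have "q (\<lambda>i. - basis k i) = - q (basis k)" by (intro q) auto
      moreover have "r x \<le> q x" for x using r(2)[of x] r0(2)[of x] by linarith
      ultimately show ?thesis using sublin_neg[OF r(1), of "basis k"]
        by (smt (verit, best))
    qed
    moreover have "r x \<le> p x" for x using r(2)[of x] r0(2)[of x] q(2)[of x] by linarith
    ultimately show ?case using r(1) by blast
  qed
  then obtain q where q: "sublin q" "\<And>x. q x \<le> p x" "q b = p b"
      "\<And>k. k \<in> {1..n} \<Longrightarrow> q (\<lambda>i. - basis k i) = - q (basis k)" by blast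
  have q_basis: "q (\<lambda>i. t * basis k i) = t * q (basis k)" if "k \<in> {1..n}" for k t
  proof (cases "0 \<le> t")
    case True
    then show ?thesis using sublin_scale[OF q(1)] by blast
  next
    case False
    then show ?thesis
      using sublin_scale[OF q(1), of "- t" "\<lambda>i. - basis k i"] q(4)[OF that] by simp
  qed
  have q_sum: "q (\<lambda>i. \<Sum>k=1..m. x k * basis k i) \<le> (\<Sum>k=1..m. x k * q (basis k))" if "m \<le> n" for m x
    using that
  proof (induction m)
    case 0
    then show ?case using sublin_zero[OF q(1)] by simp
  next
    case (Suc m)
    then show ?case
      using sublin_add[OF q(1), of "\<lambda>i. \<Sum>k=1..m. x k * basis k i" "\<lambda>i. x (Suc m) * basis (Suc m) i"]
        q_basis[of "Suc m" "x (Suc m)"] by simp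
  qed
  have q_vec: "q x \<le> (\<Sum>k=1..n. q (basis k) * x k)" if "x \<in> vecs n" for x
  proof -
    have "(\<lambda>i. \<Sum>k=1..n. x k * basis k i) = x"
      using that by (auto simp: fun_eq_iff basis_def vecs_def if_distrib cong: if_cong)
    then show ?thesis using q_sum[of n x] by (simp add: mult.commute)
  qed
  \<comment> \<open>The upper bound at \<open>- x\<close> together with
    \<open>0 \<le> q x + q (- x)\<close> turns the inequality into an equality.\<close>
  have q_eq: "q x = (\<Sum>k=1..n. q (basis k) * x k)" if "x \<in> vecs n" for x
  proof -
    have "(\<lambda>i. - x i) \<in> vecs n" using that by (simp add: vecs_def)
    from q_vec[OF this] q_vec[OF that] sublin_neg[OF q(1), of x] show ?thesis
      by (simp add: sum_negf)
  qed
  show ?thesis by (rule that[of "\<lambda>k. q (basis k)"]) (metis q(2) q_eq, metis q(3) q_eq b)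
qed

section \<open>The second-stage linear program as a function of its right-hand side\<close>

definition feasible_wv :: "nat \<Rightarrow> vec \<Rightarrow> vec \<Rightarrow> vec \<Rightarrow> bool" where
  "feasible_wv n b w v \<longleftrightarrow> (\<forall>i\<in>{1..n}. w (Suc i) - v i = b i + w i) \<and>
     (\<forall>i\<in>{1..n+1}. 0 \<le> w i) \<and> w 1 = 0 \<and> (\<forall>i\<in>{1..n}. 0 \<le> v i)"

definition cost_wv :: "nat \<Rightarrow> vec \<Rightarrow> vec \<Rightarrow> real \<Rightarrow> vec \<Rightarrow> vec \<Rightarrow> vec \<Rightarrow> real" where
  "cost_wv n c d C l w v = (\<Sum>i=1..n. c i * l i * w i + d i * v i) + C * w (n+1)"

definition lpval :: "nat \<Rightarrow> vec \<Rightarrow> vec \<Rightarrow> real \<Rightarrow> vec \<Rightarrow> vec \<Rightarrow> real" where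
  "lpval n c d C l b = Inf {cost_wv n c d C l w v | w v. feasible_wv n b w v}"

text \<open>For fixed \<open>l\<close> the scenario and the schedule enter only through the
  difference \<open>m - s\<close>, in which the value is sublinear.\<close>

lemma gval_eq_lpval: "gval n c d C s (m, l) = lpval n c d C l (\<lambda>i. m i - s i)"
proof -
  have "(\<forall>i\<in>{2..n+1}. w i - v (i-1) = m (i-1) + w (i-1) - s (i-1)) \<longleftrightarrow>
        (\<forall>i\<in>{1..n}. w (Suc i) - v i = m i - s i + w i)" for w v :: vec
  proof -
    have eq: "{2..n+1} = Suc ` {1..n}" by (simp add: image_Suc_atLeastAtMost numeral_2_eq_2)
    show ?thesis unfolding eq by (simp add: Set.ball_simps(9) algebra_simps del: image_Suc_atLeastAtMost)
  qed
  then show ?thesis unfolding gval_def lpval_def feasible_wv_def cost_wv_def by simp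
qed

text \<open>Complete recourse: the waiting time grows by \<bar>b\<bar> in every slot and the idle
  time absorbs the excess \<open>\<bar>b\<bar> - b\<close>.\<close>

lemma lp_feasible: "\<exists>w v. feasible_wv n b w v"
  by (intro exI[of _ "\<lambda>i. \<Sum>k\<in>{1..<i}. \<bar>b k\<bar>"] exI[of _ "\<lambda>i. \<bar>b i\<bar> - b i"])
    (auto simp: feasible_wv_def intro!: sum_nonneg)

context
  fixes n :: nat and c d l :: vec and C :: real
  assumes cost_nonneg: "\<And>i. i \<in> {1..n} \<Longrightarrow> 0 \<le> c i * l i" "\<And>i. i \<in> {1..n} \<Longrightarrow> 0 \<le> d i" "0 \<le> C"
begin

lemma cost_wv_nonneg: "feasible_wv n b w v \<Longrightarrow> 0 \<le> cost_wv n c d C l w v"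
  unfolding feasible_wv_def cost_wv_def using cost_nonneg
  by (intro add_nonneg_nonneg sum_nonneg mult_nonneg_nonneg[of "c _ * l _"]) auto

lemma lpval_le:
  assumes "feasible_wv n b w v" shows "lpval n c d C l b \<le> cost_wv n c d C l w v"
  unfolding lpval_def using assms cost_wv_nonneg
  by (intro cInf_lower) (auto intro!: bdd_belowI[where m=0])

lemma lpval_ge:
  assumes "\<And>w v. feasible_wv n b w v \<Longrightarrow> m \<le> cost_wv n c d C l w v"
  shows "m \<le> lpval n c d C l b"
  unfolding lpval_def using assms lp_feasible[of n b] by (intro cInf_greatest) auto

lemma lpval_approx:
  assumes "0 < e" obtains w v where "feasible_wv n b w v" "cost_wv n c d C l w v < lpval n c d C l b + e"
  using lpval_ge[of b "lpval n c d C l b + e"] assms by (meson add_le_same_cancel1 not_le)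

text \<open>Feasible pairs may be added and scaled together with their right-hand sides, at additive
  and proportional cost. Near-optimal pairs stand in for minimisers.\<close>

lemma sublin_lpval: "sublin (lpval n c d C l)"
proof (rule sublinI)
  fix x y
  show "lpval n c d C l (\<lambda>i. x i + y i) \<le> lpval n c d C l x + lpval n c d C l y"
  proof (rule field_le_epsilon)
    fix e :: real assume "0 < e"
    then have "0 < e / 2" by simp
    obtain w v where wv: "feasible_wv n x w v" "cost_wv n c d C l w v < lpval n c d C l x + e / 2"
      by (rule lpval_approx[OF \<open>0 < e / 2\<close>])
    obtain w' v' where wv': "feasible_wv n y w' v'" "cost_wv n c d C l w' v' < lpval n c d C l y + e / 2"
      by (rule lpval_approx[OF \<open>0 < e / 2\<close>])
    have "feasible_wv n (\<lambda>i. x i + y i) (\<lambda>i. w i + w' i) (\<lambda>i. v i + v' i)"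
      using wv(1) wv'(1) by (auto simp: feasible_wv_def algebra_simps)
    from lpval_le[OF this] wv(2) wv'(2)
    show "lpval n c d C l (\<lambda>i. x i + y i) \<le> lpval n c d C l x + lpval n c d C l y + e"
      by (simp add: cost_wv_def algebra_simps sum.distrib)
  qed
next
  fix x and t :: real assume t: "0 < t"
  have "lpval n c d C l (\<lambda>i. t * x i) / t \<le> lpval n c d C l x"
  proof (rule lpval_ge)
    fix w v assume "feasible_wv n x w v"
    then have "feasible_wv n (\<lambda>i. t * x i) (\<lambda>i. t * w i) (\<lambda>i. t * v i)"
      using t by (auto simp: feasible_wv_def simp flip: distrib_left right_diff_distrib)
    from lpval_le[OF this] show "lpval n c d C l (\<lambda>i. t * x i) / t \<le> cost_wv n c d C l w v"
      using t by (simp add: cost_wv_def field_simps sum_distrib_left sum_distrib_right)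
  qed
  then show "lpval n c d C l (\<lambda>i. t * x i) \<le> t * lpval n c d C l x"
    using t by (simp add: field_simps)
next
  have "feasible_wv n (\<lambda>_. 0) (\<lambda>_. 0) (\<lambda>_. 0)" by (simp add: feasible_wv_def)
  from lpval_le[OF this] have "lpval n c d C l (\<lambda>_. 0) \<le> 0" by (simp add: cost_wv_def)
  moreover have "0 \<le> lpval n c d C l (\<lambda>_. 0)" by (rule lpval_ge) (rule cost_wv_nonneg)
  ultimately show "lpval n c d C l (\<lambda>_. 0) = 0" by simp
qed

lemma lpval_nonneg: "0 \<le> lpval n c d C l b"
  by (rule lpval_ge) (rule cost_wv_nonneg)

text \<open>A linear functional supporting the value function at \<open>b\<close> is a dual
  solution. Each dual constraint is the support inequality at a right-hand side solved by one unit
  of one variable: v_k = 1 gives \<open>- y k \<le> d k\<close>, w_k = 1 gives the bound on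
  \<open>y (k-1) - y k\<close>, and w_(n+1) = 1 gives \<open>y n \<le> C\<close>.\<close>

lemma lpval_strong_duality:
  assumes "b \<in> vecs n" and "1 \<le> n"
  obtains y where "y \<in> Ycal n c d C l" "(\<Sum>i=1..n. b i * y i) = lpval n c d C l b"
proof -
  obtain y where y: "\<And>x. x \<in> vecs n \<Longrightarrow> (\<Sum>i=1..n. y i * x i) \<le> lpval n c d C l x"
    "(\<Sum>i=1..n. y i * b i) = lpval n c d C l b"
    by (rule sublin_support[OF sublin_lpval assms(1)]) blast
  define y' where "y' i = (if i \<in> {1..n} then y i else 0)" for i
  have dual: "(\<Sum>i=1..n. y' i * x i) \<le> cost_wv n c d C l w v" if "x \<in> vecs n" "feasible_wv n x w v" for x w v
    proof -
    have "(\<Sum>i=1..n. y' i * x i) = (\<Sum>i=1..n. y i * x i)" by (intro sum.cong) (auto simp: y'_def)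
    then show ?thesis using y(1)[OF that(1)] lpval_le[OF that(2)] by simp
  qed
  have delta': "(\<Sum>i=1..n. f i * (if i = k then r else 0)) = (if k \<in> {1..n} then f k * r else 0)"
    for f :: vec and k r by (simp add: if_distrib cong: if_cong)
  note delta = delta' delta'[unfolded One_nat_def]
  have "- y' k \<le> d k" if "k \<in> {1..n}" for k
  proof -
    have "(\<Sum>i=1..n. y' i * (if i = k then -1 else 0))
        \<le> cost_wv n c d C l (\<lambda>_. 0) (\<lambda>i. if i = k then 1 else 0)"
      by (rule dual) (use that in \<open>auto simp: vecs_def feasible_wv_def\<close>)
    then show ?thesis using that by (simp add: delta cost_wv_def)
  qed
  moreover have "y' (k - 1) - y' k \<le> c k * l k" if "k \<in> {2..n}" for k
  proof -
    have "(\<Sum>i=1..n. y' i * ((if i = k - 1 then 1 else 0) + (if i = k then -1 else 0)))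
        \<le> cost_wv n c d C l (\<lambda>i. if i = k then 1 else 0) (\<lambda>_. 0)"
      by (rule dual) (use that in \<open>auto simp: vecs_def feasible_wv_def\<close>)
    moreover have "k - 1 \<in> {1..n}" using that by auto
    ultimately show ?thesis using that
      by (simp add: distrib_left sum.distrib delta cost_wv_def)
  qed
  moreover have "y' n \<le> C"
  proof -
    have "(\<Sum>i=1..n. y' i * (if i = n then 1 else 0))
        \<le> cost_wv n c d C l (\<lambda>i. if i = n + 1 then 1 else 0) (\<lambda>_. 0)"
      by (rule dual) (use assms(2) in \<open>auto simp: vecs_def feasible_wv_def\<close>)
    then show ?thesis using assms(2) by (simp add: delta cost_wv_def)
  qed
  ultimately have "y' \<in> Ycal n c d C l" by (auto simp: Ycal_def vecs_def y'_def)
  moreover have "(\<Sum>i=1..n. b i * y' i) = lpval n c d C l b"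
    unfolding y(2)[symmetric] by (intro sum.cong) (auto simp: y'_def)
  ultimately show ?thesis using that by blast
qed

lemma lpval_weak_duality:
  assumes y: "y \<in> Ycal n c d C l" and "1 \<le> n"
  shows "(\<Sum>i=1..n. b i * y i) \<le> lpval n c d C l b"
proof (rule lpval_ge)
  fix w v assume f: "feasible_wv n b w v"
  \<comment> \<open>Summation by parts after substituting \<open>b i = w (i+1) - v i - w i\<close>;
    the last sum starts at 2 because \<open>w 1 = 0\<close>.\<close>
  have parts: "(\<Sum>i=1..m. b i * y i) = w (Suc m) * y m - (\<Sum>i=1..m. v i * y i) + (\<Sum>i=2..m. w i * (y (i-1) - y i))"
    if "1 \<le> m" "m \<le> n" for m
    using that
  proof (induction m rule: dec_induct)
    case base
    have "b 1 = w (Suc 1) - v 1" using f \<open>1 \<le> n\<close> by (force simp: feasible_wv_def)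
    then show ?case by (simp add: left_diff_distrib)
  next
    case (step m)
    have "b (Suc m) = w (Suc (Suc m)) - v (Suc m) - w (Suc m)"
      using f step by (force simp: feasible_wv_def)
    then have "b (Suc m) * y (Suc m) = w (Suc (Suc m)) * y (Suc m) - v (Suc m) * y (Suc m) - w (Suc m) * y (Suc m)"
      by (simp add: left_diff_distrib)
    then show ?case using step by (simp add: right_diff_distrib)
  qed
  have "y n * w (Suc n) \<le> C * w (Suc n)"
    using f y by (auto simp: feasible_wv_def Ycal_def intro!: mult_right_mono)
  moreover have "- (\<Sum>i=1..n. v i * y i) \<le> (\<Sum>i=1..n. d i * v i)"
  proof -
    have "v i * - y i \<le> v i * d i" if "i \<in> {1..n}" for i
      using that f y by (intro mult_left_mono) (auto simp: feasible_wv_def Ycal_def)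
    then show ?thesis unfolding sum_negf[symmetric]
      by (intro sum_mono) (simp add: mult.commute)
  qed
  moreover have "(\<Sum>i=2..n. w i * (y (i-1) - y i)) \<le> (\<Sum>i=2..n. w i * (c i * l i))"
    using f y by (intro sum_mono mult_left_mono) (auto simp: feasible_wv_def Ycal_def)
  moreover have "(\<Sum>i=1..n. c i * l i * w i) = (\<Sum>i=2..n. w i * (c i * l i))"
    using f \<open>1 \<le> n\<close>
    by (simp add: sum.atLeast_Suc_atMost[of "Suc 0"] feasible_wv_def numeral_2_eq_2 mult.commute)
  ultimately show "(\<Sum>i=1..n. b i * y i) \<le> cost_wv n c d C l w v"
    using parts[OF \<open>1 \<le> n\<close> order_refl] by (simp add: cost_wv_def sum.distrib mult.commute)
qed

end

section \<open>Measurability of the second-stage value\<close>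

text \<open>The Lindley recursion for waiting times with a nonnegative excess \<bar>r\<bar> added in
  each slot. The index is shifted: \<open>wpath b r i\<close> plays the role of
  \<open>w (i+1)\<close>, so the initial 0 encodes \<open>w 1 = 0\<close>.\<close>

primrec wpath :: "vec \<Rightarrow> vec \<Rightarrow> nat \<Rightarrow> real" where
  "wpath b r 0 = 0"
| "wpath b r (Suc i) = max 0 (wpath b r i + b (Suc i)) + \<bar>r (Suc i)\<bar>"

definition cost_path :: "nat \<Rightarrow> vec \<Rightarrow> vec \<Rightarrow> real \<Rightarrow> vec \<Rightarrow> vec \<Rightarrow> vec \<Rightarrow> real" where
  "cost_path n c d C l b r = (\<Sum>i=1..n. c i * l i * wpath b r (i - 1)
     + d i * (wpath b r i - wpath b r (i - 1) - b i)) + C * wpath b r n"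

text \<open>Slack variables \<open>r\<close> remove the constraints of the linear program, so that the
  objective becomes jointly continuous in the data for each fixed \<open>r\<close>.\<close>
lemma cost_set_eq_range:
  "{cost_wv n c d C l w v | w v. feasible_wv n b w v} = range (cost_path n c d C l b)"
proof (intro set_eqI iffI)
  fix x assume "x \<in> {cost_wv n c d C l w v | w v. feasible_wv n b w v}"
  then obtain w v where x: "x = cost_wv n c d C l w v" and f: "feasible_wv n b w v" by blast
  \<comment> \<open>This excess is nonnegative since \<open>w (i+1)\<close> is at least 0 and,
    because \<open>v i\<close> is nonnegative, at least \<open>w i + b i\<close>; the absolute value
    in \<open>wpath\<close> therefore leaves it unchanged.\<close>
  define r where "r i = w (Suc i) - max 0 (w i + b i)" for i
  have wv: "w (Suc i) - v i = b i + w i" "0 \<le> w (Suc i)" "0 \<le> v i" if "1 \<le> i" "i \<le> n" for i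
    using f that by (auto simp: feasible_wv_def)
  have w: "wpath b r i = w (Suc i)" if "i \<le> n" for i
    using that
  proof (induction i)
    case 0
    then show ?case using f by (simp add: feasible_wv_def)
  next
    case (Suc i)
    then show ?case using wv[of "Suc i"] by (simp add: r_def)
  qed
  have "x = cost_path n c d C l b r"
    unfolding x cost_wv_def cost_path_def
  proof (intro arg_cong2[where f="(+)"] sum.cong refl)
    fix i assume i: "i \<in> {1..n}"
    then have "wpath b r (i - 1) = w i" "wpath b r i = w (Suc i)" using w[of "i - 1"] w[of i] by auto
    then show "c i * l i * w i = c i * l i * wpath b r (i - 1)"
      "d i * v i = d i * (wpath b r i - wpath b r (i - 1) - b i)" using wv[of i] i by (auto simp: algebra_simps)
  qed (use w in simp)
  then show "x \<in> range (cost_path n c d C l b)" by blast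
next
  fix x assume "x \<in> range (cost_path n c d C l b)"
  then obtain r where x: "x = cost_path n c d C l b r" by blast
  have step: "wpath b r i + b (Suc i) \<le> wpath b r (Suc i)" for i by simp
  have nonneg: "0 \<le> wpath b r i" for i by (cases i) auto
  let ?w = "\<lambda>i. wpath b r (i - 1)" and ?v = "\<lambda>i. wpath b r i - wpath b r (i - 1) - b i"
  have "0 \<le> ?v i" if "i \<in> {1..n}" for i using that step[of "i - 1"] by (cases i) auto
  then have "feasible_wv n b ?w ?v" by (auto simp: feasible_wv_def nonneg simp del: wpath.simps(2))
  moreover have "x = cost_wv n c d C l ?w ?v" by (simp add: x cost_path_def cost_wv_def)
  ultimately show "x \<in> {cost_wv n c d C l w v | w v. feasible_wv n b w v}" by blast
qed

lemma continuous_on_wpath: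
  assumes "\<And>i. continuous_on UNIV (\<lambda>x. b x i)"
  shows "continuous_on UNIV (\<lambda>x. wpath (b x) r i)"
  by (induction i) (auto intro!: continuous_intros assms)

lemma continuous_on_fst_coord: "continuous_on A (\<lambda>x. fst x (i :: nat) :: real)"
  by (rule continuous_on_product_then_coordinatewise) (intro continuous_intros)

lemma continuous_on_snd_coord: "continuous_on A (\<lambda>x. snd x (i :: nat) :: real)"
  by (rule continuous_on_product_then_coordinatewise) (intro continuous_intros)

text \<open>The real infimum of a set unbounded below is a default value obtained from an
  unsatisfiable predicate, hence the same for all such sets. Scenarios outside \<open>Xi\<close> may
  make the linear program unbounded, and measurability is claimed on the whole space.\<close>

lemma Inf_not_bdd_below: "\<not> bdd_below X \<Longrightarrow> Inf X = Inf (UNIV :: real set)"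
proof -
  have "\<not> bdd_below X \<Longrightarrow> Inf X = - (LEAST z :: real. False)" for X
    unfolding Inf_real_def Sup_real_def bdd_below_def
    by (intro arg_cong[where f="\<lambda>P. - (LEAST z. P z)"]) (auto simp: fun_eq_iff, metis minus_le_iff)
  moreover have "\<not> bdd_below (UNIV :: real set)" unfolding bdd_below_def by (auto simp: not_le intro: lt_ex)
  ultimately show "\<not> bdd_below X \<Longrightarrow> Inf X = Inf UNIV" by metis
qed

text \<open>The infimum over \<open>r\<close> is uncountable, but its strict sublevel sets are
  unions of open sets. It is taken in the extended reals, where it is always meaningful; the
  real-valued \<open>Inf\<close> differs from it only at minus infinity, by a constant.\<close>

lemma gval_measurable: "gval n c d C s \<in> borel_measurable borel"
proof -
  define f where "f r x = cost_path n c d C (snd x) (\<lambda>i. fst x i - s i) r" for r and x :: scen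
  define e where "e x = (INF r. ereal (f r x))" for x
  have cont: "continuous_on UNIV (f r)" for r
    unfolding f_def cost_path_def
    by (intro continuous_intros continuous_on_wpath continuous_on_fst_coord continuous_on_snd_coord)
  have "e \<in> borel_measurable borel"
  proof (rule borel_measurableI_less)
    fix a
    have "{x \<in> space borel. e x < a} = (\<Union>r. {x. ereal (f r x) < a})"
      unfolding e_def by (auto simp: INF_less_iff)
    also have "open \<dots>"
      by (intro open_UN ballI open_Collect_less continuous_on_ereal cont continuous_intros)
    finally show "{x \<in> space borel. e x < a} \<in> sets borel" by simp
  qed
  moreover have "gval n c d C s = (\<lambda>x. if e x = -\<infinity> then Inf UNIV else real_of_ereal (e x))"
  proof
    fix x :: scen
    have g: "gval n c d C s x = Inf (range (\<lambda>r. f r x))"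
      by (cases x) (simp add: gval_eq_lpval lpval_def cost_set_eq_range f_def)
    show "gval n c d C s x = (if e x = -\<infinity> then Inf UNIV else real_of_ereal (e x))"
    proof (cases "bdd_below (range (\<lambda>r. f r x))")
      case True
      then have "ereal (Inf (range (\<lambda>r. f r x))) = e x"
        by (subst ereal_Inf') (auto simp: e_def image_comp)
      then show ?thesis unfolding g by (metis MInfty_neq_ereal(1) real_of_ereal.simps(1))
    next
      case False
      have "e x \<le> ereal m" for m
      proof -
        obtain r where "f r x < m" using False by (auto simp: bdd_below_def not_le)
        then have "ereal (f r x) \<le> ereal m" by simp
        moreover have "e x \<le> ereal (f r x)" unfolding e_def by (rule INF_lower) simp
        ultimately show ?thesis by order
      qed
      then have "e x = -\<infinity>" using ereal_bot by blast
      then show ?thesis unfolding g using Inf_not_bdd_below[OF False] by simp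
    qed
  qed
  ultimately show ?thesis by simp
qed

section \<open>Wasserstein duality\<close>

text \<open>Each plan over the budget bounds \<rho> from below by a slope, each plan under the
  budget bounds it from above. Mixing one plan of either kind shows that every lower bound is at
  most every upper bound, so the supremum of the lower bounds serves as \<rho>.\<close>

lemma lagrange_multiplier:
  fixes \<kappa> \<gamma> :: "'a \<Rightarrow> real"
  assumes a0: "a0 \<in> S" "\<kappa> a0 < E"
    and mix: "\<And>a a' \<theta>. a \<in> S \<Longrightarrow> a' \<in> S \<Longrightarrow> 0 \<le> \<theta> \<Longrightarrow> \<theta> \<le> 1 \<Longrightarrow>
      \<theta> * \<kappa> a + (1 - \<theta>) * \<kappa> a' \<le> E \<Longrightarrow> \<theta> * \<gamma> a + (1 - \<theta>) * \<gamma> a' \<le> v"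
  obtains \<rho> where "0 \<le> \<rho>" "\<And>a. a \<in> S \<Longrightarrow> \<gamma> a + \<rho> * (E - \<kappa> a) \<le> v"
proof -
  \<comment> \<open>The added 0 forces \<rho> \<ge> 0; the strictly feasible \<open>a0\<close> is
    what bounds \<open>L\<close> from above.\<close>
  define L where "L = insert 0 ((\<lambda>a. (\<gamma> a - v) / (\<kappa> a - E)) ` {a \<in> S. E < \<kappa> a})"
  have pure: "\<gamma> a \<le> v" if "a \<in> S" "\<kappa> a \<le> E" for a
    using mix[of a a 1] that by simp
  have cross: "(\<gamma> a - v) / (\<kappa> a - E) \<le> (v - \<gamma> a') / (E - \<kappa> a')"
    if "a \<in> S" "a' \<in> S" "E < \<kappa> a" "\<kappa> a' < E" for a a'
  proof -
    define D where "D = \<kappa> a - \<kappa> a'"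
    have D: "0 < D" using that by (simp add: D_def)
    have comp: "1 - (E - \<kappa> a') / D = (\<kappa> a - E) / D"
      using D by (simp add: D_def field_simps)
    \<comment> \<open>With this weight the mixture of \<open>a\<close> and \<open>a'\<close> costs
      exactly \<open>E\<close>.\<close>
    have "(E - \<kappa> a') / D * \<gamma> a + (1 - (E - \<kappa> a') / D) * \<gamma> a' \<le> v"
    proof (rule mix[OF that(1,2)])
      have "(E - \<kappa> a') / D * \<kappa> a + (1 - (E - \<kappa> a') / D) * \<kappa> a' = E * D / D"
        unfolding comp unfolding D_def add_divide_distrib[symmetric] times_divide_eq_left
        by (simp add: algebra_simps)
      then show "(E - \<kappa> a') / D * \<kappa> a + (1 - (E - \<kappa> a') / D) * \<kappa> a' \<le> E" using D by simp
    qed (use that D in \<open>auto simp: D_def\<close>)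
    then have "((E - \<kappa> a') * \<gamma> a + (\<kappa> a - E) * \<gamma> a') / D \<le> v"
      unfolding comp by (simp add: add_divide_distrib)
    then have "(E - \<kappa> a') * \<gamma> a + (\<kappa> a - E) * \<gamma> a' \<le> v * D"
      using D by (simp add: field_simps)
    then have "(\<gamma> a - v) * (E - \<kappa> a') \<le> (v - \<gamma> a') * (\<kappa> a - E)"
      by (simp add: D_def algebra_simps)
    then show ?thesis using that by (simp add: divide_le_eq le_divide_eq mult.commute)
  qed
  have upper: "x \<le> (v - \<gamma> a') / (E - \<kappa> a')" if "x \<in> L" "a' \<in> S" "\<kappa> a' < E" for x a'
    using that cross pure[of a'] by (auto simp: L_def intro!: divide_nonneg_nonneg)
  have bdd: "bdd_above L" using upper[OF _ a0] by (rule bdd_aboveI)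
  have "0 \<le> Sup L" by (rule cSup_upper[OF _ bdd]) (simp add: L_def)
  moreover have "\<gamma> a + Sup L * (E - \<kappa> a) \<le> v" if "a \<in> S" for a
  proof (cases "\<kappa> a" E rule: linorder_cases)
    case less
    have "Sup L \<le> (v - \<gamma> a) / (E - \<kappa> a)"
      by (rule cSup_least) (use upper that less in \<open>auto simp: L_def\<close>)
    then show ?thesis using less by (simp add: field_simps)
  next
    case equal
    then show ?thesis using pure[OF that] by simp
  next
    case greater
    have "(\<gamma> a - v) / (\<kappa> a - E) \<le> Sup L"
      by (rule cSup_upper[OF _ bdd]) (use greater that in \<open>auto simp: L_def\<close>)
    then have "\<gamma> a - v \<le> Sup L * (\<kappa> a - E)" using greater by (simp add: divide_le_eq)
    then show ?thesis by (simp add: algebra_simps)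
  qed
  ultimately show ?thesis using that by blast
qed

lemma costp_nonneg: "0 \<le> costp n p x y"
  unfolding costp_def by (intro sum_nonneg) auto

lemma costp_measurable: "(\<lambda>z. costp n p (fst z) (snd z)) \<in> borel_measurable borel"
proof -
  have "continuous_on UNIV (\<lambda>z :: scen \<times> scen. fst (fst z) i)" "continuous_on UNIV (\<lambda>z :: scen \<times> scen. fst (snd z) i)"
    "continuous_on UNIV (\<lambda>z :: scen \<times> scen. snd (fst z) i)" "continuous_on UNIV (\<lambda>z :: scen \<times> scen. snd (snd z) i)" for i
    by (rule continuous_on_product_then_coordinatewise, intro continuous_intros)+
  then show ?thesis unfolding costp_def
    by (intro borel_measurable_continuous_onI continuous_intros)
qed

lemma wass_dist_le_iff:
  assumes "1 \<le> p" "0 < \<epsilon>"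
  shows "wass_dist n p Q1 Q2 \<le> ereal \<epsilon> \<longleftrightarrow>
    (INF P\<in>couplings Q1 Q2. \<integral>\<^sup>+ z. ennreal (costp n p (fst z) (snd z)) \<partial>P) \<le> ennreal (\<epsilon> ^ p)"
    (is "_ \<longleftrightarrow> ?W \<le> _")
proof (cases "?W = \<top>")
  case True
  then show ?thesis by (simp add: wass_dist_def top_unique)
next
  case False
  then obtain w where w: "0 \<le> w" "?W = ennreal w" by (cases ?W) auto
  have "w powr (1 / real p) \<le> \<epsilon> \<longleftrightarrow> w \<le> \<epsilon> ^ p"
  proof -
    have "w powr (1 / real p) \<le> \<epsilon> \<longleftrightarrow> (w powr (1 / real p)) powr real p \<le> \<epsilon> powr real p"
      using assms powr_mono2[of "real p" "w powr (1 / real p)" \<epsilon>]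
        powr_less_mono2[of "real p" \<epsilon> "w powr (1 / real p)"] by force
    also have "(w powr (1 / real p)) powr real p = w" using assms w(1) by (simp add: powr_powr)
    also have "\<epsilon> powr real p = \<epsilon> ^ p" using assms(2) by (simp add: powr_realpow)
    finally show ?thesis .
  qed
  then show ?thesis using w assms by (simp add: wass_dist_def)
qed

lemma integral_emp_dist:
  fixes f :: "scen \<Rightarrow> real"
  assumes "1 \<le> N"
  shows "(\<integral>x. f x \<partial>emp_dist N muh lamh) = 1 / real N * (\<Sum>j=1..N. f (muh j, lamh j))"
  using assms by (simp add: emp_dist_def integral_pmf_of_set)

text \<open>The pointwise dual inequality is integrated against a nearly optimal coupling, whose
  first marginal gives the expectation of \<open>g\<close> and whose second gives the average over
  the data.\<close>

lemma wasserstein_weak_duality: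
  fixes g :: "scen \<Rightarrow> real"
  assumes Q: "Q \<in> amb n K uL uU p N muh lamh \<epsilon>" and "1 \<le> p" "1 \<le> N" "0 < \<epsilon>" "0 \<le> \<rho>"
    and g: "g \<in> borel_measurable borel" "\<And>x. x \<in> Xi n K uL uU \<Longrightarrow> \<bar>g x\<bar> \<le> H"
    and dual: "\<And>x j. x \<in> Xi n K uL uU \<Longrightarrow> j \<in> {1..N} \<Longrightarrow> g x \<le> \<rho> * costp n p x (muh j, lamh j) + \<beta> j"
  shows "(\<integral>x. g x \<partial>Q) \<le> \<epsilon> ^ p * \<rho> + 1 / real N * (\<Sum>j=1..N. \<beta> j)"
proof -
  define xs where "xs j = (muh j, lamh j)" for j
  define D where "D = xs ` {1..N}"
  \<comment> \<open>Data points may coincide while their \<beta> differ, so a function on scenarios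
    takes the smallest \<beta> among the indices sharing a point.\<close>
  define h where "h y = (if y \<in> D then Min (\<beta> ` {j \<in> {1..N}. xs j = y}) else 0)" for y
  have "finite D" by (simp add: D_def)
  have h_le: "h (xs j) \<le> \<beta> j" if "j \<in> {1..N}" for j
    using that by (auto simp: h_def D_def)
  have h_dual: "g x \<le> \<rho> * costp n p x y + h y" if "x \<in> Xi n K uL uU" "y \<in> D" for x y
  proof -
    have "h y \<in> \<beta> ` {j \<in> {1..N}. xs j = y}"
      using that unfolding h_def by (simp, intro Min_in) (auto simp: D_def)
    then show ?thesis using dual[OF that(1)] by (auto simp: xs_def)
  qed
  have "h = (\<lambda>y. \<Sum>a\<in>D. h a * indicator {a} y)"
    by (auto simp: fun_eq_iff h_def indicator_def if_distrib \<open>finite D\<close> cong: if_cong)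
  moreover have "(\<lambda>y. \<Sum>a\<in>D. h a * indicator {a} y) \<in> borel_measurable borel" by measurable
  ultimately have h_meas [measurable]: "h \<in> borel_measurable borel" by simp
  have Q': "prob_space Q" "sets Q = sets borel" "AE x in Q. x \<in> Xi n K uL uU"
    "wass_dist n p Q (emp_dist N muh lamh) \<le> ereal \<epsilon>"
    using Q by (auto simp: amb_def distributions_on_def)
  let ?W = "INF P\<in>couplings Q (emp_dist N muh lamh). \<integral>\<^sup>+ z. ennreal (costp n p (fst z) (snd z)) \<partial>P"
  have W: "?W \<le> ennreal (\<epsilon> ^ p)" using Q'(4) wass_dist_le_iff[OF assms(2,4)] by blast
  \<comment> \<open>The infimum over couplings need not be attained; the slack \<delta> admits a
    coupling of cost below \<open>\<epsilon> ^ p + \<delta>\<close>.\<close>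
  have main: "(\<integral>x. g x \<partial>Q) \<le> \<rho> * (\<epsilon> ^ p + \<delta>) + 1 / real N * (\<Sum>j=1..N. h (xs j))" if "0 < \<delta>" for \<delta>
  proof -
    have "?W < ennreal (\<epsilon> ^ p + \<delta>)"
      using W assms(4) that by (auto intro: le_less_trans simp: ennreal_less_iff)
    then obtain P where P: "P \<in> couplings Q (emp_dist N muh lamh)"
      and Pc: "(\<integral>\<^sup>+ z. ennreal (costp n p (fst z) (snd z)) \<partial>P) < ennreal (\<epsilon> ^ p + \<delta>)"
      by (auto simp: INF_less_iff)
    interpret P: prob_space P using P by (simp add: couplings_def)
    have sP [measurable_cong]: "sets P = sets borel" using P by (simp add: couplings_def)
    have spP: "space P = UNIV" using sets_eq_imp_space_eq[OF sP] by simp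
    have fst_m [measurable]: "fst \<in> measurable P (borel :: scen measure)"
      and snd_m [measurable]: "snd \<in> measurable P (borel :: scen measure)"
      unfolding measurable_cong_sets[OF sP refl]
      by (intro borel_measurable_continuous_onI continuous_intros)+
    have dQ: "distr P borel fst = Q"
    proof (rule measure_eqI)
      fix A :: "scen set" assume "A \<in> sets (distr P borel fst)"
      then have A: "A \<in> sets borel" by simp
      have "fst -` A = A \<times> (UNIV :: scen set)" by auto
      then show "emeasure (distr P borel fst) A = emeasure Q A"
        using P A by (simp add: emeasure_distr spP couplings_def)
    qed (simp add: Q'(2))
    \<comment> \<open>The empirical distribution carries the discrete sigma-algebra, so the two
      measures can agree only after it is pushed to the Borel sets.\<close>
    have dE: "distr P borel snd = distr (emp_dist N muh lamh) borel (\<lambda>x. x)"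
    proof (rule measure_eqI)
      fix A :: "scen set" assume "A \<in> sets (distr P borel snd)"
      then have A: "A \<in> sets borel" by simp
      have "snd -` A = (UNIV :: scen set) \<times> A" by auto
      then show "emeasure (distr P borel snd) A = emeasure (distr (emp_dist N muh lamh) borel (\<lambda>x. x)) A"
        using P A by (simp add: emeasure_distr spP couplings_def emp_dist_def)
    qed simp
    have "AE z in P. fst z \<in> Xi n K uL uU"
      using Q'(3) unfolding dQ[symmetric] by (rule AE_distrD[OF fst_m])
    moreover have "AE z in P. snd z \<in> D"
    proof (rule AE_distrD[OF snd_m])
      show "AE x in distr P borel snd. x \<in> D"
        unfolding dE
      proof (subst AE_distr_iff)
        show "AE x in emp_dist N muh lamh. x \<in> D"
          unfolding emp_dist_def using assms(3) by (auto simp: AE_measure_pmf_iff D_def xs_def)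
      qed (use \<open>finite D\<close> in \<open>auto simp: emp_dist_def intro: borel_closed finite_imp_closed\<close>)
    qed
    ultimately have AE: "AE z in P. \<bar>g (fst z)\<bar> \<le> H \<and> g (fst z) \<le> \<rho> * costp n p (fst z) (snd z) + h (snd z)"
      by eventually_elim (use g(2) h_dual in blast)
    have c_meas [measurable]: "(\<lambda>z. costp n p (fst z) (snd z)) \<in> borel_measurable P"
      unfolding measurable_cong_sets[OF sP refl] by (rule costp_measurable)
    have c_int: "integrable P (\<lambda>z. costp n p (fst z) (snd z))"
      using Pc by (intro integrableI_bounded) (auto simp: costp_nonneg intro: order.strict_trans)
    have c_le: "(\<integral>z. costp n p (fst z) (snd z) \<partial>P) \<le> \<epsilon> ^ p + \<delta>"
    proof -
      have "ennreal (\<integral>z. costp n p (fst z) (snd z) \<partial>P) < ennreal (\<epsilon> ^ p + \<delta>)"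
        using Pc nn_integral_eq_integral[OF c_int] by (simp add: costp_nonneg)
      then show ?thesis using assms(4) that by (simp add: ennreal_less_iff costp_nonneg del: ennreal_plus)
    qed
    have gm [measurable]: "g \<in> borel_measurable borel" by (rule g)
    have g_int: "integrable P (\<lambda>z. g (fst z))"
      using AE by (intro P.integrable_const_bound[where B=H]) auto
    have h_int: "integrable P (\<lambda>z. h (snd z))"
    proof (intro P.integrable_const_bound[where B="Max (insert 0 ((\<lambda>a. \<bar>h a\<bar>) ` D))"] AE_I2)
      fix z :: "scen \<times> scen"
      show "norm (h (snd z)) \<le> Max (insert 0 ((\<lambda>a. \<bar>h a\<bar>) ` D))"
        using \<open>finite D\<close> by (cases "snd z \<in> D") (auto simp: h_def intro!: Max_ge)
    qed measurable
    have "(\<integral>x. g x \<partial>Q) = (\<integral>z. g (fst z) \<partial>P)"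
      unfolding dQ[symmetric] by (rule integral_distr) measurable
    also have "\<dots> \<le> (\<integral>z. \<rho> * costp n p (fst z) (snd z) + h (snd z) \<partial>P)"
      using AE by (intro integral_mono_AE g_int Bochner_Integration.integrable_add integrable_mult_right c_int h_int) auto
    also have "\<dots> = \<rho> * (\<integral>z. costp n p (fst z) (snd z) \<partial>P) + (\<integral>z. h (snd z) \<partial>P)"
      using c_int h_int by simp
    also have "(\<integral>z. h (snd z) \<partial>P) = (\<integral>x. h x \<partial>distr P borel snd)"
      by (rule integral_distr[symmetric]) measurable
    also have "\<dots> = (\<integral>x. h x \<partial>emp_dist N muh lamh)"
      unfolding dE by (rule integral_distr) (auto simp: emp_dist_def)
    also have "\<dots> = 1 / real N * (\<Sum>j=1..N. h (xs j))"
      unfolding xs_def by (rule integral_emp_dist[OF assms(3)])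
    finally show ?thesis using mult_left_mono[OF c_le assms(5)] by linarith
  qed
  have "(\<integral>x. g x \<partial>Q) \<le> \<epsilon> ^ p * \<rho> + 1 / real N * (\<Sum>j=1..N. h (xs j))"
  proof (rule field_le_epsilon)
    fix e :: real assume "0 < e"
    \<comment> \<open>Dividing by \<open>\<rho> + 1\<close> covers the case \<rho> = 0 as
      well.\<close>
    then have "\<rho> * (e / (\<rho> + 1)) \<le> e" "0 < e / (\<rho> + 1)" using assms(5) by (auto simp: field_simps)
    then show "(\<integral>x. g x \<partial>Q) \<le> \<epsilon> ^ p * \<rho> + 1 / real N * (\<Sum>j=1..N. h (xs j)) + e"
      using main[of "e / (\<rho> + 1)"] by (simp add: algebra_simps)
  qed
  also have "\<dots> \<le> \<epsilon> ^ p * \<rho> + 1 / real N * (\<Sum>j=1..N. \<beta> j)"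
    using h_le by (intro add_left_mono mult_left_mono sum_mono) auto
  finally show ?thesis .
qed

text \<open>A coin of bias \<theta> selects the plan and an independent uniform index selects the
  data point. The pair of target and source is a coupling with the empirical distribution, and its
  cost is the averaged cost.\<close>

lemma wasserstein_mixture:
  fixes g :: "scen \<Rightarrow> real"
  assumes v: "\<And>Q. Q \<in> amb n K uL uU p N muh lamh \<epsilon> \<Longrightarrow> (\<integral>x. g x \<partial>Q) \<le> v"
    and "1 \<le> p" "1 \<le> N" "0 < \<epsilon>"
    and g: "g \<in> borel_measurable borel"
    and \<theta>: "0 \<le> \<theta>" "\<theta> \<le> 1"
    and x: "\<And>j. j \<in> {1..N} \<Longrightarrow> x j \<in> Xi n K uL uU" "\<And>j. j \<in> {1..N} \<Longrightarrow> x' j \<in> Xi n K uL uU"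
    and cost: "\<theta> * (1 / real N * (\<Sum>j=1..N. costp n p (x j) (muh j, lamh j)))
       + (1 - \<theta>) * (1 / real N * (\<Sum>j=1..N. costp n p (x' j) (muh j, lamh j))) \<le> \<epsilon> ^ p"
  shows "\<theta> * (1 / real N * (\<Sum>j=1..N. g (x j))) + (1 - \<theta>) * (1 / real N * (\<Sum>j=1..N. g (x' j))) \<le> v"
proof -
  define M where "M = bernoulli_pmf \<theta> \<bind>
    (\<lambda>b. map_pmf (\<lambda>j. (if b then x j else x' j, (muh j, lamh j))) (pmf_of_set {1..N}))"
  have setN: "set_pmf (pmf_of_set {1..N}) = {1..N}" using assms(3) by simp
  have M_exp: "measure_pmf.expectation M f =
      \<theta> * (1 / real N * (\<Sum>j=1..N. f (x j, (muh j, lamh j))))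
      + (1 - \<theta>) * (1 / real N * (\<Sum>j=1..N. f (x' j, (muh j, lamh j))))" for f :: "scen \<times> scen \<Rightarrow> real"
    unfolding M_def using \<theta> assms(3)
    by (subst pmf_expectation_bind[where A=UNIV]) (auto simp: setN UNIV_bool integral_pmf_of_set)
  have M_set: "finite (set_pmf M)" "set_pmf M \<subseteq> Xi n K uL uU \<times> UNIV"
    using x assms(3) by (auto simp: M_def setN)
  have M_snd: "map_pmf snd M = map_pmf (\<lambda>j. (muh j, lamh j)) (pmf_of_set {1..N})"
    by (simp add: M_def map_bind_pmf pmf.map_comp o_def)
  \<comment> \<open>Pushed from the discrete sigma-algebra to the Borel sets, where couplings and
    distributions live.\<close>
  define P where "P = distr (measure_pmf M) borel (\<lambda>z. z)"
  define Q where "Q = distr (measure_pmf M) borel fst"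
  have "P \<in> couplings Q (emp_dist N muh lamh)"
    unfolding couplings_def
  proof (intro CollectI conjI ballI)
    show "prob_space P" unfolding P_def by (rule measure_pmf.prob_space_distr) simp
    fix A :: "scen set" assume A: "A \<in> sets borel"
    then have "A \<times> (UNIV :: scen set) \<in> sets borel" "(UNIV :: scen set) \<times> A \<in> sets borel"
      by (metis pair_measureI borel_prod sets.top space_borel)+
    moreover have "A \<times> (UNIV :: scen set) = fst -` A" "(UNIV :: scen set) \<times> A = snd -` A" by auto
    ultimately show "emeasure P (A \<times> UNIV) = emeasure Q A"
      "emeasure P (UNIV \<times> A) = emeasure (emp_dist N muh lamh) A"
      using A unfolding P_def Q_def emp_dist_def M_snd[symmetric]
      by (simp_all add: emeasure_distr)
  qed (simp add: P_def)
  moreover have "(\<integral>\<^sup>+ z. ennreal (costp n p (fst z) (snd z)) \<partial>P) \<le> ennreal (\<epsilon> ^ p)"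
  proof -
    have "(\<integral>\<^sup>+ z. ennreal (costp n p (fst z) (snd z)) \<partial>P)
        = (\<integral>\<^sup>+ z. ennreal (costp n p (fst z) (snd z)) \<partial>measure_pmf M)"
      unfolding P_def using costp_measurable[of n p] by (intro nn_integral_distr) auto
    also have "\<dots> = ennreal (measure_pmf.expectation M (\<lambda>z. costp n p (fst z) (snd z)))"
      by (intro nn_integral_eq_integral integrable_measure_pmf_finite M_set) (simp add: costp_nonneg)
    also have "\<dots> \<le> ennreal (\<epsilon> ^ p)" unfolding M_exp using cost by (intro ennreal_leI) simp
    finally show ?thesis .
  qed
  ultimately have "wass_dist n p Q (emp_dist N muh lamh) \<le> ereal \<epsilon>"
    unfolding wass_dist_le_iff[OF assms(2,4)] by (rule INF_lower2)
  moreover have "Q \<in> distributions_on (Xi n K uL uU)"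
    unfolding distributions_on_def
  proof (intro CollectI conjI)
    show "prob_space Q" unfolding Q_def by (rule measure_pmf.prob_space_distr) simp
    have "finite (fst ` set_pmf M)" using M_set by simp
    then have "fst ` set_pmf M \<in> sets borel" by (auto intro: borel_closed finite_imp_closed)
    then have "AE y in Q. y \<in> fst ` set_pmf M"
      unfolding Q_def by (subst AE_distr_iff) (auto simp: AE_measure_pmf_iff)
    then show "AE y in Q. y \<in> Xi n K uL uU"
      by (rule eventually_mono) (use M_set in auto)
  qed (simp add: Q_def)
  ultimately have "(\<integral>y. g y \<partial>Q) \<le> v" by (intro v) (simp add: amb_def)
  also have "(\<integral>y. g y \<partial>Q) = measure_pmf.expectation M (\<lambda>z. g (fst z))"
    unfolding Q_def by (rule integral_distr) (use g in auto)
  finally show ?thesis unfolding M_exp by simp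
qed

text \<open>The bound is stated for whole plans. As its j-th summand depends on \<open>x j\<close>
  alone, it can later be split into one supremum per data point.\<close>

lemma wasserstein_strong_duality:
  fixes g :: "scen \<Rightarrow> real"
  assumes v: "\<And>Q. Q \<in> amb n K uL uU p N muh lamh \<epsilon> \<Longrightarrow> (\<integral>x. g x \<partial>Q) \<le> v"
    and "1 \<le> p" "1 \<le> N" "0 < \<epsilon>"
    and g: "g \<in> borel_measurable borel"
    and data: "\<And>j. j \<in> {1..N} \<Longrightarrow> (muh j, lamh j) \<in> Xi n K uL uU"
  obtains \<rho> where "0 \<le> \<rho>"
    "\<And>x. (\<And>j. j \<in> {1..N} \<Longrightarrow> x j \<in> Xi n K uL uU) \<Longrightarrow>
      \<epsilon> ^ p * \<rho> + 1 / real N * (\<Sum>j=1..N. g (x j) - \<rho> * costp n p (x j) (muh j, lamh j)) \<le> v"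
proof -
  let ?\<kappa> = "\<lambda>x. 1 / real N * (\<Sum>j=1..N. costp n p (x j) (muh j, lamh j))"
  let ?\<gamma> = "\<lambda>x. 1 / real N * (\<Sum>j=1..N. g (x j))"
  let ?S = "{x. \<forall>j\<in>{1..N}. x j \<in> Xi n K uL uU}"
  obtain \<rho> where \<rho>: "0 \<le> \<rho>" "\<And>x. x \<in> ?S \<Longrightarrow> ?\<gamma> x + \<rho> * (\<epsilon> ^ p - ?\<kappa> x) \<le> v"
  proof (rule lagrange_multiplier[of "\<lambda>j. (muh j, lamh j)" ?S ?\<kappa> "\<epsilon> ^ p" ?\<gamma> v])
    show "(\<lambda>j. (muh j, lamh j)) \<in> ?S" using data by simp
    have "costp n p y y = 0" for y using assms(2) by (simp add: costp_def)
    then show "?\<kappa> (\<lambda>j. (muh j, lamh j)) < \<epsilon> ^ p" using assms(4) by simp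
    fix x x' \<theta> assume "x \<in> ?S" "x' \<in> ?S" "0 \<le> \<theta>" "\<theta> \<le> 1" "\<theta> * ?\<kappa> x + (1 - \<theta>) * ?\<kappa> x' \<le> \<epsilon> ^ p"
    then show "\<theta> * ?\<gamma> x + (1 - \<theta>) * ?\<gamma> x' \<le> v"
      by (intro wasserstein_mixture[OF v assms(2-4) g]) auto
  qed blast
  show ?thesis
  proof (rule that[OF \<rho>(1)])
    fix x assume "\<And>j. j \<in> {1..N} \<Longrightarrow> x j \<in> Xi n K uL uU"
    then have "?\<gamma> x + \<rho> * (\<epsilon> ^ p - ?\<kappa> x) \<le> v" by (intro \<rho>(2)) auto
    then show "\<epsilon> ^ p * \<rho> + 1 / real N * (\<Sum>j=1..N. g (x j) - \<rho> * costp n p (x j) (muh j, lamh j)) \<le> v"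
      by (simp add: sum_subtractf sum_distrib_left right_diff_distrib algebra_simps)
  qed
qed

section \<open>Exact penalty for the binary constraints\<close>

text \<open>Controls the change of the p-th power transport cost on a bounded range, via
  \<open>u * (u ^ p - w ^ p) + w ^ p * (u - w)\<close>.\<close>

lemma power_lipschitz:
  fixes R :: real
  shows "\<exists>L\<ge>0. \<forall>u w. 0 \<le> u \<and> u \<le> R \<and> 0 \<le> w \<and> w \<le> R \<longrightarrow> \<bar>u ^ p - w ^ p\<bar> \<le> L * \<bar>u - w\<bar>"
proof (induction p)
  case 0
  then show ?case by (intro exI[of _ 0]) simp
next
  case (Suc p)
  then obtain L where L: "0 \<le> L"
    "\<And>u w. 0 \<le> u \<and> u \<le> R \<and> 0 \<le> w \<and> w \<le> R \<Longrightarrow> \<bar>u ^ p - w ^ p\<bar> \<le> L * \<bar>u - w\<bar>" by blast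
  have "\<bar>u ^ Suc p - w ^ Suc p\<bar> \<le> (\<bar>R\<bar> * L + \<bar>R\<bar> ^ p) * \<bar>u - w\<bar>"
    if *: "0 \<le> u \<and> u \<le> R \<and> 0 \<le> w \<and> w \<le> R" for u w
  proof -
    have "u ^ Suc p - w ^ Suc p = u * (u ^ p - w ^ p) + w ^ p * (u - w)" by (simp add: algebra_simps)
    also have "\<bar>\<dots>\<bar> \<le> \<bar>u\<bar> * \<bar>u ^ p - w ^ p\<bar> + \<bar>w ^ p\<bar> * \<bar>u - w\<bar>"
      by (metis abs_mult abs_triangle_ineq)
    also have "\<dots> \<le> \<bar>R\<bar> * (L * \<bar>u - w\<bar>) + \<bar>R\<bar> ^ p * \<bar>u - w\<bar>"
      using * L by (intro add_mono mult_mono) (auto intro!: power_mono)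
    finally show ?thesis by (simp add: algebra_simps)
  qed
  then show ?case using L(1) by (intro exI[of _ "\<bar>R\<bar> * L + \<bar>R\<bar> ^ p"]) auto
qed

text \<open>The least vector meeting the constraints that bound \<open>y\<close> from below, namely
  \<open>- y i \<le> d i\<close> and the difference constraints. The value at 0 is a filler, and
  index 1 does not refer to it.\<close>

primrec lowest_y :: "vec \<Rightarrow> vec \<Rightarrow> vec \<Rightarrow> nat \<Rightarrow> real" where
  "lowest_y c d l 0 = 0"
| "lowest_y c d l (Suc i) = (if i = 0 then - d (Suc i)
     else max (- d (Suc i)) (lowest_y c d l i - c (Suc i) * l (Suc i)))"

locale no_show =
  fixes n K :: nat and C :: real and c d uL uU :: vec
  assumes n_pos: "1 \<le> n"
    and c_nonneg: "\<And>i. i \<in> {1..n} \<Longrightarrow> 0 \<le> c i" and d_nonneg: "\<And>i. i \<in> {1..n} \<Longrightarrow> 0 \<le> d i"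
    and C_nonneg: "0 \<le> C"
    and uL_nonneg: "\<And>i. i \<in> {1..n} \<Longrightarrow> 0 \<le> uL i" and uL_le_uU: "\<And>i. i \<in> {1..n} \<Longrightarrow> uL i \<le> uU i"
begin

definition relaxed :: "vec \<Rightarrow> vec \<Rightarrow> vec \<Rightarrow> bool" where
  "relaxed m l y \<longleftrightarrow> (\<forall>i\<in>{1..n}. 0 \<le> l i \<and> l i \<le> 1 \<and> uL i * l i \<le> m i \<and> m i \<le> uU i * l i) \<and>
     (\<Sum>i=1..n. 1 - l i) \<le> real K \<and> y \<in> Ycal n c d C l"

definition Usum :: real where "Usum = (\<Sum>i=1..n. uU i)"
definition Csum :: real where "Csum = (\<Sum>i=1..n. c i)"
definition Ybound :: real where "Ybound = C + Csum + (\<Sum>i=1..n. d i)"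

lemma uU_nonneg: "i \<in> {1..n} \<Longrightarrow> 0 \<le> uU i"
  using uL_nonneg uL_le_uU by force

lemma uU_le_Usum: "i \<in> {1..n} \<Longrightarrow> uU i \<le> Usum"
  unfolding Usum_def using uU_nonneg by (intro member_le_sum) auto

lemma c_le_Csum: "i \<in> {1..n} \<Longrightarrow> c i \<le> Csum"
  unfolding Csum_def using c_nonneg by (intro member_le_sum) auto

lemma Usum_nonneg: "0 \<le> Usum" unfolding Usum_def using uU_nonneg by (intro sum_nonneg) auto
lemma Csum_nonneg: "0 \<le> Csum" unfolding Csum_def using c_nonneg by (intro sum_nonneg) auto
lemma Ybound_nonneg: "0 \<le> Ybound" unfolding Ybound_def
  using Csum_nonneg C_nonneg d_nonneg by (intro add_nonneg_nonneg sum_nonneg) auto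

lemma mu_bounds:
  assumes "i \<in> {1..n}" "0 \<le> t" "t \<le> 1" "uL i * t \<le> m" "m \<le> uU i * t"
  shows "0 \<le> m" "m \<le> Usum"
proof -
  have "0 \<le> uL i * t" using uL_nonneg assms by simp
  with assms show "0 \<le> m" by simp
  have "uU i * t \<le> uU i" using uU_nonneg assms by (simp add: mult_left_le)
  with assms uU_le_Usum show "m \<le> Usum" by force
qed

text \<open>Going backwards from \<open>y n \<le> C\<close>, each step adds at most
  \<open>c k\<close> because \<open>l k \<le> 1\<close>; from below \<open>- d i\<close> applies
  directly.\<close>

lemma y_bound:
  assumes y: "y \<in> Ycal n c d C l" and l: "\<And>i. i \<in> {1..n} \<Longrightarrow> l i \<le> 1" and i: "i \<in> {1..n}"
  shows "\<bar>y i\<bar> \<le> Ybound"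
proof -
  have y_step: "y (i - 1) - y i \<le> c i * l i" if "i \<in> {2..n}" for i using y that by (simp add: Ycal_def)
  have tail: "y i \<le> C + (\<Sum>k=Suc i..n. c k)" if "i \<le> n" "1 \<le> i" for i
    using that
  proof (induction i rule: inc_induct)
    case base
    then show ?case using y by (simp add: Ycal_def)
  next
    case (step i)
    have "y i - y (Suc i) \<le> c (Suc i) * l (Suc i)" using y_step[of "Suc i"] step by auto
    also have "\<dots> \<le> c (Suc i)" using l c_nonneg step by (simp add: mult_left_le)
    finally have "y i \<le> c (Suc i) + y (Suc i)" by simp
    moreover have "(\<Sum>k=Suc i..n. c k) = c (Suc i) + (\<Sum>k=Suc (Suc i)..n. c k)"
      using step by (simp add: sum.atLeast_Suc_atMost)
    ultimately show ?case using step by simp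
  qed
  have "(\<Sum>k=Suc i..n. c k) \<le> Csum"
    unfolding Csum_def using c_nonneg by (intro sum_mono2) auto
  moreover have "d i \<le> (\<Sum>i=1..n. d i)" using i d_nonneg by (intro member_le_sum) auto
  moreover have "0 \<le> (\<Sum>i=1..n. d i)" using d_nonneg by (intro sum_nonneg) auto
  moreover have "- y i \<le> d i" using y i by (simp add: Ycal_def)
  ultimately show ?thesis using tail[of i] i Csum_nonneg C_nonneg unfolding Ybound_def by auto
qed

text \<open>Lowering \<open>y i\<close> by the tail sum of the perturbations \<open>e k\<close>
  repairs every difference constraint but may fall below \<open>- d i\<close>. The componentwise
  maximum with the lowest solution repairs this, since difference constraints and upper bounds
  survive maxima.\<close>

lemma Ycal_lipschitz:
  assumes y: "y \<in> Ycal n c d C l" and l0: "\<And>i. i \<in> {1..n} \<Longrightarrow> 0 \<le> l0 i"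
  obtains y0 where "y0 \<in> Ycal n c d C l0"
    "\<And>i. i \<in> {1..n} \<Longrightarrow> \<bar>y i - y0 i\<bar> \<le> (\<Sum>k=1..n. c k * \<bar>l k - l0 k\<bar>)"
proof -
  define e where "e k = c k * \<bar>l k - l0 k\<bar>" for k
  define low where "low = lowest_y c d l0"
  define z where "z i = y i - (\<Sum>k=Suc i..n. e k)" for i
  define y0 where "y0 i = (if i \<in> {1..n} then max (z i) (low i) else 0)" for i
  have e: "0 \<le> e k" if "k \<in> {1..n}" for k using c_nonneg[OF that] by (simp add: e_def)
  have low_d: "- d i \<le> low i" if "i \<in> {1..n}" for i
    using that by (cases i) (auto simp: low_def)
  have low_step: "low (i - 1) - low i \<le> c i * l0 i" if "i \<in> {2..n}" for i
    using that by (cases i) (auto simp: low_def)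
  have low_neg: "low i \<le> 0" if "i \<le> n" for i
    using that
  proof (induction i)
    case (Suc i)
    moreover have "0 \<le> c (Suc i) * l0 (Suc i)" "0 \<le> d (Suc i)"
      using Suc.prems c_nonneg l0 d_nonneg by auto
    ultimately show ?case by (auto simp: low_def)
  qed (simp add: low_def)
  have c_l0: "c i * l i - e i \<le> c i * l0 i" if "i \<in> {1..n}" for i
  proof -
    have "c i * (l i - \<bar>l i - l0 i\<bar>) \<le> c i * l0 i" using c_nonneg[OF that] by (intro mult_left_mono) auto
    then show ?thesis by (simp add: e_def right_diff_distrib)
  qed
  have y_step: "y (i - 1) - y i \<le> c i * l i" if "i \<in> {2..n}" for i using y that by (simp add: Ycal_def)
  have z_step: "z (i - 1) - z i \<le> c i * l0 i" if "i \<in> {2..n}" for i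
  proof -
    have "(\<Sum>k=Suc (i - 1)..n. e k) = e i + (\<Sum>k=Suc i..n. e k)"
      using that by (simp add: sum.atLeast_Suc_atMost)
    then show ?thesis using y_step[OF that] c_l0[of i] that by (auto simp: z_def)
  qed
  \<comment> \<open>The lowest solution for \<open>l0\<close> exceeds the old \<open>y\<close> by no
    more than the perturbations accumulated so far, so raising to it is a small move too.\<close>
  have y_low: "low i \<le> y i + (\<Sum>k=1..i. e k)" if "1 \<le> i" "i \<le> n" for i
    using that
  proof (induction i rule: dec_induct)
    case base
    have "- y 1 \<le> d 1" using y n_pos by (force simp: Ycal_def)
    moreover have "0 \<le> e 1" using n_pos by (intro e) auto
    ultimately show ?case by (simp add: low_def)
  next
    case (step i)
    have "- y (Suc i) \<le> d (Suc i)" using y step by (force simp: Ycal_def)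
    moreover have "0 \<le> (\<Sum>k=1..Suc i. e k)" using e step by (intro sum_nonneg) auto
    moreover have "y i - y (Suc i) \<le> c (Suc i) * l (Suc i)" using y_step[of "Suc i"] step by auto
    moreover have "c (Suc i) * l (Suc i) \<le> c (Suc i) * l0 (Suc i) + e (Suc i)"
      using c_l0[of "Suc i"] step by auto
    ultimately show ?case using step by (simp add: low_def)
  qed
  have "y0 \<in> Ycal n c d C l0"
    unfolding Ycal_def
  proof (intro CollectI conjI ballI)
    show "y0 \<in> vecs n" by (simp add: vecs_def y0_def)
    show "- y0 i \<le> d i" if "i \<in> {1..n}" for i
      using low_d[OF that] that by (auto simp: y0_def)
    show "y0 (i - 1) - y0 i \<le> c i * l0 i" if "i \<in> {2..n}" for i
    proof -
      have "i - 1 \<in> {1..n}" "i \<in> {1..n}" using that by auto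
      then have "y0 (i - 1) = max (z (i - 1)) (low (i - 1))" "y0 i = max (z i) (low i)"
        unfolding y0_def by presburger+
      then show ?thesis using z_step[OF that] low_step[OF that] by linarith
    qed
    show "y0 n \<le> C" using low_neg[of n] C_nonneg y n_pos by (auto simp: y0_def z_def Ycal_def)
  qed
  moreover have "\<bar>y i - y0 i\<bar> \<le> (\<Sum>k=1..n. c k * \<bar>l k - l0 k\<bar>)" if i: "i \<in> {1..n}" for i
  proof -
    have "(\<Sum>k=Suc i..n. e k) \<le> (\<Sum>k=1..n. e k)" "(\<Sum>k=1..i. e k) \<le> (\<Sum>k=1..n. e k)"
      "0 \<le> (\<Sum>k=Suc i..n. e k)" using e i by (auto intro!: sum_mono2 sum_nonneg)
    moreover have "low i \<le> y i + (\<Sum>k=1..i. e k)" using y_low i by simp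
    moreover have "y0 i = max (z i) (low i)" "z i = y i - (\<Sum>k=Suc i..n. e k)"
      using i by (simp_all add: y0_def z_def)
    ultimately show ?thesis unfolding e_def[symmetric] by linarith
  qed
  ultimately show ?thesis using that by blast
qed

text \<open>At \<open>t0 = 0\<close> only 0 is admissible, and \<open>a\<close> is at most
  \<open>uU i * t\<close>; at \<open>t0 = 1\<close> the upper bound already holds, and raising
  \<open>a\<close> to \<open>uL i\<close> costs at most \<open>uL i * (1 - t)\<close>.\<close>

lemma mu_lipschitz:
  assumes i: "i \<in> {1..n}" and t: "0 \<le> t" "t \<le> 1" "uL i * t \<le> a" "a \<le> uU i * t"
    and t0: "t0 = 0 \<or> t0 = 1"
  shows "\<exists>a0. uL i * t0 \<le> a0 \<and> a0 \<le> uU i * t0 \<and> \<bar>a - a0\<bar> \<le> Usum * \<bar>t - t0\<bar>"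
  using t0
proof
  assume "t0 = 0"
  have "uU i * t \<le> Usum * t" using uU_le_Usum[OF i] t by (intro mult_right_mono) auto
  with \<open>t0 = 0\<close> show ?thesis using t mu_bounds(1)[OF i t] by (intro exI[of _ 0]) auto
next
  assume "t0 = 1"
  have "uU i * t \<le> uU i" using t uU_nonneg[OF i] by (simp add: mult_left_le)
  moreover have "uL i * (1 - t) \<le> Usum * (1 - t)"
    using uL_le_uU[OF i] uU_le_Usum[OF i] t by (intro mult_right_mono) auto
  moreover have "0 \<le> Usum * (1 - t)" using Usum_nonneg t by simp
  ultimately show ?thesis using \<open>t0 = 1\<close> t uL_le_uU[OF i]
    by (intro exI[of _ "max (uL i) a"]) (auto simp: algebra_simps max_def)
qed

lemma XiD:
  assumes "(m, l) \<in> Xi n K uL uU"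
  shows "m \<in> vecs n" "l \<in> vecs n" "\<And>i. i \<in> {1..n} \<Longrightarrow> l i = 0 \<or> l i = 1"
    "\<And>i. i \<in> {1..n} \<Longrightarrow> 0 \<le> l i \<and> l i \<le> 1 \<and> uL i * l i \<le> m i \<and> m i \<le> uU i * l i"
    "(\<Sum>i=1..n. 1 - l i) \<le> real K"
proof -
  show b: "\<And>i. i \<in> {1..n} \<Longrightarrow> l i = 0 \<or> l i = 1" and "m \<in> vecs n" "l \<in> vecs n"
    "(\<Sum>i=1..n. 1 - l i) \<le> real K" using assms by (auto simp: Xi_def Lam_def)
  show "0 \<le> l i \<and> l i \<le> 1 \<and> uL i * l i \<le> m i \<and> m i \<le> uU i * l i" if "i \<in> {1..n}" for i
    using b[OF that] that assms by (auto simp: Xi_def)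
qed

lemma gval_ge:
  assumes "\<And>i. i \<in> {1..n} \<Longrightarrow> 0 \<le> l i" "y \<in> Ycal n c d C l"
  shows "(\<Sum>i=1..n. (m i - s i) * y i) \<le> gval n c d C s (m, l)"
  unfolding gval_eq_lpval using assms c_nonneg d_nonneg C_nonneg n_pos
  by (intro lpval_weak_duality) auto

lemma gval_nonneg:
  assumes "\<And>i. i \<in> {1..n} \<Longrightarrow> 0 \<le> l i"
  shows "0 \<le> gval n c d C s (m, l)"
  unfolding gval_eq_lpval using assms c_nonneg d_nonneg C_nonneg by (intro lpval_nonneg) auto

lemma gval_dual:
  assumes "(m, l) \<in> Xi n K uL uU" "s \<in> vecs n"
  obtains y where "relaxed m l y" "gval n c d C s (m, l) = (\<Sum>i=1..n. (m i - s i) * y i)"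
proof -
  have l: "0 \<le> l i" if "i \<in> {1..n}" for i using XiD(4)[OF assms(1) that] by blast
  have "(\<lambda>i. m i - s i) \<in> vecs n" using XiD(1)[OF assms(1)] assms(2) by (simp add: vecs_def)
  then obtain y where "y \<in> Ycal n c d C l"
    "(\<Sum>i=1..n. (m i - s i) * y i) = lpval n c d C l (\<lambda>i. m i - s i)"
    using l c_nonneg d_nonneg C_nonneg n_pos
    by (elim lpval_strong_duality[of n c l d C "\<lambda>i. m i - s i", rotated 3]) auto
  then show ?thesis using that[of y] XiD[OF assms(1)] by (auto simp: relaxed_def gval_eq_lpval)
qed

lemma bilinear_bound:
  assumes "relaxed m l y"
  shows "(\<Sum>i=1..n. (m i - s i) * y i) \<le> real n * ((Usum + (\<Sum>i=1..n. \<bar>s i\<bar>)) * Ybound)"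
proof -
  have "(m i - s i) * y i \<le> (Usum + (\<Sum>i=1..n. \<bar>s i\<bar>)) * Ybound" if i: "i \<in> {1..n}" for i
  proof -
    have "\<bar>s i\<bar> \<le> (\<Sum>i=1..n. \<bar>s i\<bar>)" using i by (intro member_le_sum) auto
    moreover have "0 \<le> m i" "m i \<le> Usum" using assms i mu_bounds[of i "l i" "m i"] by (auto simp: relaxed_def)
    ultimately have "\<bar>m i - s i\<bar> \<le> Usum + (\<Sum>i=1..n. \<bar>s i\<bar>)" by linarith
    moreover have "\<bar>y i\<bar> \<le> Ybound" using assms i by (intro y_bound[of y l]) (auto simp: relaxed_def)
    ultimately have "\<bar>m i - s i\<bar> * \<bar>y i\<bar> \<le> (Usum + (\<Sum>i=1..n. \<bar>s i\<bar>)) * Ybound"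
      by (intro mult_mono) auto
    then show ?thesis by (metis abs_ge_self abs_mult order_trans)
  qed
  from sum_mono[of "{1..n}", OF this] show ?thesis by simp
qed

lemma gval_bounded:
  assumes "s \<in> vecs n" obtains H where "\<And>x. x \<in> Xi n K uL uU \<Longrightarrow> \<bar>gval n c d C s x\<bar> \<le> H"
proof (rule that)
  fix x assume "x \<in> Xi n K uL uU"
  then obtain m l where x: "x = (m, l)" "(m, l) \<in> Xi n K uL uU" by (cases x) auto
  obtain y where y: "relaxed m l y" "gval n c d C s (m, l) = (\<Sum>i=1..n. (m i - s i) * y i)"
    by (rule gval_dual[OF x(2) assms])
  have "0 \<le> gval n c d C s (m, l)" using XiD(4)[OF x(2)] by (intro gval_nonneg) auto
  then show "\<bar>gval n c d C s x\<bar> \<le> real n * ((Usum + (\<Sum>i=1..n. \<bar>s i\<bar>)) * Ybound)"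
    using bilinear_bound[OF y(1), of s] y(2) x(1) by simp
qed

text \<open>The binary constraints admit an exact penalty because the relaxed feasible set is
  Lipschitz in \<open>l\<close>; a rounding violating the no-show budget \<open>K\<close> is at distance at least 1
  by integrality of \<open>K\<close>.\<close>
lemma exact_penalty:
  assumes s: "s \<in> vecs n" and \<rho>: "0 \<le> \<rho>" and p: "1 \<le> p" and hat: "(mh, lh) \<in> Xi n K uL uU"
    and B: "\<And>x. x \<in> Xi n K uL uU \<Longrightarrow> gval n c d C s x - \<rho> * costp n p x (mh, lh) \<le> B"
  obtains L where "0 \<le> L"
    "\<And>m l y l0. relaxed m l y \<Longrightarrow> (\<And>i. i \<in> {1..n} \<Longrightarrow> l0 i = 0 \<or> l0 i = 1) \<Longrightarrow>
      (\<Sum>i=1..n. (m i - s i) * y i) - \<rho> * costp n p (m, l) (mh, lh) \<le> B + L * (\<Sum>i=1..n. \<bar>l i - l0 i\<bar>)"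
proof -
  define S where "S = (\<Sum>i=1..n. \<bar>s i\<bar>)"
  \<comment> \<open>The range \<open>Usum + 1\<close> covers the distances of durations, at most
    \<open>Usum\<close>, and of no-show indicators, at most 1.\<close>
  obtain Lp where Lp: "0 \<le> Lp"
    "\<And>u w. 0 \<le> u \<and> u \<le> Usum + 1 \<and> 0 \<le> w \<and> w \<le> Usum + 1 \<Longrightarrow> \<bar>u ^ p - w ^ p\<bar> \<le> Lp * \<bar>u - w\<bar>"
    using power_lipschitz[of "Usum + 1" p] by blast
  define H where "H = real n * ((Usum + S) * Ybound)"
  \<comment> \<open>The three summands bound the effect of moving \<open>m\<close>, of moving
    \<open>y\<close>, and of the change in transport cost; \<open>H\<close> above is the crude bound
    used when the rounding breaks the budget.\<close>
  define L1 where "L1 = Usum * Ybound + real n * ((Usum + S) * Csum) + \<rho> * (Lp * (Usum + 1))"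
  have S: "0 \<le> S" unfolding S_def by (intro sum_nonneg) auto
  have H: "0 \<le> H" unfolding H_def using S Usum_nonneg Ybound_nonneg by simp
  have L1: "0 \<le> L1" unfolding L1_def using S Usum_nonneg Ybound_nonneg Csum_nonneg \<rho> Lp by simp
  \<comment> \<open>The data point itself has cost zero and nonnegative value, so \<open>B\<close>
    is nonnegative; in the infeasible case the penalty alone must dominate.\<close>
  have "costp n p (mh, lh) (mh, lh) = 0" using p by (simp add: costp_def)
  then have B0: "0 \<le> B"
    using B[OF hat] gval_nonneg[of lh s mh] XiD(4)[OF hat] by force
  have main: "(\<Sum>i=1..n. (m i - s i) * y i) - \<rho> * costp n p (m, l) (mh, lh)
      \<le> B + (L1 + H) * (\<Sum>i=1..n. \<bar>l i - l0 i\<bar>)"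
    if r: "relaxed m l y" and l0v: "l0 \<in> vecs n" and l0: "\<And>i. i \<in> {1..n} \<Longrightarrow> l0 i = 0 \<or> l0 i = 1" for m l y l0
  proof (cases "(\<Sum>i=1..n. 1 - l0 i) \<le> real K")
    case False
    have "(\<Sum>i=1..n. 1 - l0 i) = (\<Sum>i=1..n. if l0 i = 0 then 1 else 0)"
      using l0 by (intro sum.cong) force+
    also have "\<dots> = real (card {i \<in> {1..n}. l0 i = 0})" by (simp add: sum.If_cases Int_def)
    finally have "real K + 1 \<le> (\<Sum>i=1..n. 1 - l0 i)" using False by simp
    moreover have "(\<Sum>i=1..n. 1 - l i) \<le> real K" using r by (simp add: relaxed_def)
    moreover have "(\<Sum>i=1..n. (1 - l0 i) - (1 - l i)) \<le> (\<Sum>i=1..n. \<bar>l i - l0 i\<bar>)" by (intro sum_mono) auto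
    ultimately have \<Delta>: "1 \<le> (\<Sum>i=1..n. \<bar>l i - l0 i\<bar>)" by (simp add: sum_subtractf)
    have "0 \<le> \<rho> * costp n p (m, l) (mh, lh)" using \<rho> costp_nonneg by simp
    then have "(\<Sum>i=1..n. (m i - s i) * y i) - \<rho> * costp n p (m, l) (mh, lh) \<le> H"
      using bilinear_bound[OF r, of s] unfolding H_def S_def by simp
    also have "H \<le> (L1 + H) * (\<Sum>i=1..n. \<bar>l i - l0 i\<bar>)"
      using mult_mono[of H "L1 + H" 1 "\<Sum>i=1..n. \<bar>l i - l0 i\<bar>"] \<Delta> H L1 by simp
    finally show ?thesis using B0 by simp
  next
    case True
    define \<Delta> where "\<Delta> = (\<Sum>i=1..n. \<bar>l i - l0 i\<bar>)"
    have \<Delta>: "0 \<le> \<Delta>" unfolding \<Delta>_def by (intro sum_nonneg) auto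
    have l: "0 \<le> l i" "l i \<le> 1" "uL i * l i \<le> m i" "m i \<le> uU i * l i" if "i \<in> {1..n}" for i
      using r that by (auto simp: relaxed_def)
    have y: "y \<in> Ycal n c d C l" using r by (simp add: relaxed_def)
    have l0': "0 \<le> l0 i" if "i \<in> {1..n}" for i using l0[OF that] by auto
    obtain y0 where y0: "y0 \<in> Ycal n c d C l0"
      "\<And>i. i \<in> {1..n} \<Longrightarrow> \<bar>y i - y0 i\<bar> \<le> (\<Sum>k=1..n. c k * \<bar>l k - l0 k\<bar>)"
      by (rule Ycal_lipschitz[OF y, of l0]) (use l0' in blast)+
    have "(\<Sum>k=1..n. c k * \<bar>l k - l0 k\<bar>) \<le> (\<Sum>k=1..n. Csum * \<bar>l k - l0 k\<bar>)"
      by (intro sum_mono mult_right_mono c_le_Csum) auto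
    then have y0\<Delta>: "\<bar>y i - y0 i\<bar> \<le> Csum * \<Delta>" if "i \<in> {1..n}" for i
      using y0(2)[OF that] by (simp add: \<Delta>_def sum_distrib_left)
    have "\<forall>i\<in>{1..n}. \<exists>a0. uL i * l0 i \<le> a0 \<and> a0 \<le> uU i * l0 i \<and> \<bar>m i - a0\<bar> \<le> Usum * \<bar>l i - l0 i\<bar>"
      using mu_lipschitz l l0 by blast
    then obtain f where f: "\<And>i. i \<in> {1..n} \<Longrightarrow>
        uL i * l0 i \<le> f i \<and> f i \<le> uU i * l0 i \<and> \<bar>m i - f i\<bar> \<le> Usum * \<bar>l i - l0 i\<bar>" by metis
    define m0 where "m0 i = (if i \<in> {1..n} then f i else 0)" for i
    have m0: "uL i * l0 i \<le> m0 i" "m0 i \<le> uU i * l0 i" "\<bar>m i - m0 i\<bar> \<le> Usum * \<bar>l i - l0 i\<bar>"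
      if "i \<in> {1..n}" for i using f[OF that] that by (auto simp: m0_def)
    have "m0 \<in> vecs n" by (simp add: vecs_def m0_def)
    then have "(m0, l0) \<in> Xi n K uL uU" using True l0v l0 m0 by (simp add: Xi_def Lam_def)
    then have Bm: "gval n c d C s (m0, l0) - \<rho> * costp n p (m0, l0) (mh, lh) \<le> B" by (rule B)
    have gm: "(\<Sum>i=1..n. (m0 i - s i) * y0 i) \<le> gval n c d C s (m0, l0)"
      by (rule gval_ge) (use l0' y0 in auto)
    have m0b: "0 \<le> m0 i" "m0 i \<le> Usum" if "i \<in> {1..n}" for i
      using mu_bounds[of i "l0 i" "m0 i"] m0[OF that] l0[OF that] that by auto
    have mb: "0 \<le> m i" "m i \<le> Usum" if "i \<in> {1..n}" for i
      using mu_bounds[of i "l i" "m i"] l[OF that] that by auto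
    have mhb: "0 \<le> mh i" "mh i \<le> Usum" "0 \<le> lh i" "lh i \<le> 1" if "i \<in> {1..n}" for i
      using mu_bounds[of i "lh i" "mh i"] XiD(4)[OF hat that] that by auto
    have "(\<Sum>i=1..n. (m i - s i) * y i) - (\<Sum>i=1..n. (m0 i - s i) * y0 i)
        \<le> (\<Sum>i=1..n. Usum * \<bar>l i - l0 i\<bar> * Ybound + (Usum + S) * (Csum * \<Delta>))"
      unfolding sum_subtractf[symmetric]
    proof (rule sum_mono)
      fix i assume i: "i \<in> {1..n}"
      \<comment> \<open>The bilinear term is split as
        \<open>(m - m0) * y + (m0 - s) * (y - y0)\<close>, so each part has one small factor and one
        bounded factor.\<close>
      have "(m i - m0 i) * y i \<le> \<bar>m i - m0 i\<bar> * \<bar>y i\<bar>" by (metis abs_ge_self abs_mult)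
      also have "\<dots> \<le> Usum * \<bar>l i - l0 i\<bar> * Ybound"
        using m0(3)[OF i] y_bound[OF y _ i] l Usum_nonneg by (intro mult_mono) auto
      finally have 1: "(m i - m0 i) * y i \<le> Usum * \<bar>l i - l0 i\<bar> * Ybound" .
      have "\<bar>s i\<bar> \<le> S" unfolding S_def using i by (intro member_le_sum) auto
      then have "\<bar>m0 i - s i\<bar> \<le> Usum + S" using m0b[OF i] by linarith
      moreover have "(m0 i - s i) * (y i - y0 i) \<le> \<bar>m0 i - s i\<bar> * \<bar>y i - y0 i\<bar>" by (metis abs_ge_self abs_mult)
      ultimately have "(m0 i - s i) * (y i - y0 i) \<le> (Usum + S) * (Csum * \<Delta>)"
        using y0\<Delta>[OF i] mult_mono[of "\<bar>m0 i - s i\<bar>" "Usum + S" "\<bar>y i - y0 i\<bar>" "Csum * \<Delta>"] Usum_nonneg S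
        by linarith
      with 1 show "(m i - s i) * y i - (m0 i - s i) * y0 i
          \<le> Usum * \<bar>l i - l0 i\<bar> * Ybound + (Usum + S) * (Csum * \<Delta>)"
        by (simp add: algebra_simps)
    qed
    also have "\<dots> = Usum * Ybound * \<Delta> + real n * ((Usum + S) * Csum) * \<Delta>"
      by (simp add: sum.distrib \<Delta>_def sum_distrib_left sum_distrib_right mult_ac)
    finally have 1: "(\<Sum>i=1..n. (m i - s i) * y i) - (\<Sum>i=1..n. (m0 i - s i) * y0 i)
       \<le> Usum * Ybound * \<Delta> + real n * ((Usum + S) * Csum) * \<Delta>" .
    have "costp n p (m0, l0) (mh, lh) - costp n p (m, l) (mh, lh)
        \<le> (\<Sum>i=1..n. Lp * (Usum + 1) * \<bar>l i - l0 i\<bar>)"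
      unfolding costp_def sum_subtractf[symmetric] fst_conv snd_conv
    proof (rule sum_mono)
      fix i assume i: "i \<in> {1..n}"
      have "\<bar>\<bar>m0 i - mh i\<bar> ^ p - \<bar>m i - mh i\<bar> ^ p\<bar> \<le> Lp * \<bar>\<bar>m0 i - mh i\<bar> - \<bar>m i - mh i\<bar>\<bar>"
        using m0b[OF i] mb[OF i] mhb[OF i] by (intro Lp) auto
      also have "\<dots> \<le> Lp * (Usum * \<bar>l i - l0 i\<bar>)"
        using Lp(1) m0(3)[OF i] by (intro mult_left_mono) auto
      finally have 1: "\<bar>m0 i - mh i\<bar> ^ p - \<bar>m i - mh i\<bar> ^ p \<le> Lp * (Usum * \<bar>l i - l0 i\<bar>)" by simp
      have "\<bar>\<bar>l0 i - lh i\<bar> ^ p - \<bar>l i - lh i\<bar> ^ p\<bar> \<le> Lp * \<bar>\<bar>l0 i - lh i\<bar> - \<bar>l i - lh i\<bar>\<bar>"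
        using l0[OF i] l[OF i] mhb[OF i] Usum_nonneg by (intro Lp) auto
      also have "\<dots> \<le> Lp * \<bar>l i - l0 i\<bar>" using Lp(1) by (intro mult_left_mono) auto
      finally have "\<bar>l0 i - lh i\<bar> ^ p - \<bar>l i - lh i\<bar> ^ p \<le> Lp * \<bar>l i - l0 i\<bar>" by simp
      with 1 show "\<bar>m0 i - mh i\<bar> ^ p + \<bar>l0 i - lh i\<bar> ^ p - (\<bar>m i - mh i\<bar> ^ p + \<bar>l i - lh i\<bar> ^ p)
          \<le> Lp * (Usum + 1) * \<bar>l i - l0 i\<bar>" by (simp add: algebra_simps)
    qed
    also have "\<dots> = Lp * (Usum + 1) * \<Delta>" by (simp add: \<Delta>_def sum_distrib_left)
    finally have "\<rho> * (costp n p (m0, l0) (mh, lh) - costp n p (m, l) (mh, lh)) \<le> \<rho> * (Lp * (Usum + 1) * \<Delta>)"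
      using \<rho> by (rule mult_left_mono)
    then have "(\<Sum>i=1..n. (m i - s i) * y i) - \<rho> * costp n p (m, l) (mh, lh) \<le> B + L1 * \<Delta>"
      using 1 gm Bm by (simp add: L1_def algebra_simps)
    also have "\<dots> \<le> B + (L1 + H) * \<Delta>" using H \<Delta> by (simp add: algebra_simps)
    finally show ?thesis unfolding \<Delta>_def .
  qed
  show ?thesis
  proof (rule that)
    show "0 \<le> L1 + H" using L1 H by simp
    fix m l y and l0 :: vec assume r: "relaxed m l y" and l0: "\<And>i. i \<in> {1..n} \<Longrightarrow> l0 i = 0 \<or> l0 i = 1"
    have "(\<Sum>i=1..n. (m i - s i) * y i) - \<rho> * costp n p (m, l) (mh, lh)
        \<le> B + (L1 + H) * (\<Sum>i=1..n. \<bar>l i - (if i \<in> {1..n} then l0 i else 0)\<bar>)"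
      by (rule main[OF r]) (use l0 in \<open>auto simp: vecs_def\<close>)
    also have "(\<Sum>i=1..n. \<bar>l i - (if i \<in> {1..n} then l0 i else 0)\<bar>) = (\<Sum>i=1..n. \<bar>l i - l0 i\<bar>)"
      by (intro sum.cong) auto
    finally show "(\<Sum>i=1..n. (m i - s i) * y i) - \<rho> * costp n p (m, l) (mh, lh)
        \<le> B + (L1 + H) * (\<Sum>i=1..n. \<bar>l i - l0 i\<bar>)" .
  qed
qed

end

section \<open>Quadratic forms on perspective cones\<close>

lemma qform_add: "qform k (\<lambda>r q. M r q + M' r q) x = qform k M x + qform k M' x"
  unfolding qform_def by (simp add: algebra_simps sum.distrib)

lemma qform_diff: "qform k (\<lambda>r q. M r q - M' r q) x = qform k M x - qform k M' x"
  unfolding qform_def by (simp add: algebra_simps sum_subtractf)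

lemma qform_scale: "qform k (\<lambda>r q. a * M r q) x = a * qform k M x"
  unfolding qform_def by (simp add: sum_distrib_left mult_ac)

lemma qform_sum: "finite I \<Longrightarrow> qform k (\<lambda>r q. \<Sum>i\<in>I. M i r q) x = (\<Sum>i\<in>I. qform k (M i) x)"
proof (induction I rule: finite_induct)
  case empty
  then show ?case by (simp add: qform_def)
qed (simp add: qform_add)

lemma qform_outer_basis:
  assumes "a \<in> {1..k}" "b \<in> {1..k}"
  shows "qform k (outer (basis a) (basis b)) x = x a * x b"
proof -
  have "qform k (outer (basis a) (basis b)) x = (\<Sum>r=1..k. \<Sum>q=1..k. (if r = a then x a else 0) * (if q = b then x b else 0))"
    unfolding qform_def outer_def basis_def by (intro sum.cong) auto
  also have "\<dots> = (\<Sum>r=1..k. if r = a then x a else 0) * (\<Sum>q=1..k. if q = b then x b else 0)"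
    by (rule sum_product[symmetric])
  also have "\<dots> = x a * x b" using assms by simp
  finally show ?thesis .
qed

lemma qform_ent:
  assumes "a \<in> {1..k}" "b \<in> {1..k}"
  shows "qform k (ent a b v) x = (if a = b then v * (x a)\<^sup>2 else 2 * v * x a * x b)"
proof (cases "a = b")
  case True
  have "ent a b v = (\<lambda>r q. v * outer (basis a) (basis b) r q)"
    using True by (auto simp: ent_def outer_def basis_def fun_eq_iff)
  then show ?thesis using True assms by (simp add: qform_scale qform_outer_basis power2_eq_square)
next
  case False
  have "ent a b v = (\<lambda>r q. v * outer (basis a) (basis b) r q + v * outer (basis b) (basis a) r q)"
    using False by (auto simp: ent_def outer_def basis_def fun_eq_iff)
  then show ?thesis using False assms by (simp add: qform_scale qform_add qform_outer_basis)
qed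

definition homog :: "nat \<Rightarrow> vec \<Rightarrow> vec" where
  "homog k z = (\<lambda>i. if i = 1 then 1 else if i \<in> {2..k} then z (i - 1) else 0)"

text \<open>A quadratic form scales by t^2, so only the slice t = 1 has to be tested, and it is
  continuous, so nonnegativity passes to the closure.\<close>

lemma COP_persp_iff:
  assumes "1 \<le> k" and F: "F \<subseteq> vecs (k - 1)"
    and sym: "\<And>a b. M a b = M b a"
  shows "M \<in> COP k (persp k F) \<longleftrightarrow> (\<forall>z\<in>F. 0 \<le> qform k M (homog k z))"
proof
  assume M: "M \<in> COP k (persp k F)"
  show "\<forall>z\<in>F. 0 \<le> qform k M (homog k z)"
  proof
    fix z assume "z \<in> F"
    then have "z \<in> vecs (k - 1)" using F by blast
    then have "(\<lambda>i. if i \<in> {1..k-1} then homog k z (i+1) / homog k z 1 else 0) = z"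
      by (auto simp: homog_def vecs_def fun_eq_iff)
    from this \<open>z \<in> F\<close> have "(\<lambda>i. if i \<in> {1..k-1} then homog k z (i+1) / homog k z 1 else 0) \<in> F"
      by (rule ssubst[where P="\<lambda>w. w \<in> F"])
    moreover have "homog k z \<in> vecs k" "0 < homog k z 1" using assms(1) by (auto simp: homog_def vecs_def)
    ultimately have "homog k z \<in> {x \<in> vecs k. 0 < x 1 \<and> (\<lambda>i. if i \<in> {1..k-1} then x (i+1) / x 1 else 0) \<in> F}"
      by (intro CollectI conjI)
    then have "homog k z \<in> persp k F" unfolding persp_def by (rule subsetD[OF closure_subset])
    then show "0 \<le> qform k M (homog k z)" using M by (simp add: COP_def)
  qed
next
  assume pos: "\<forall>z\<in>F. 0 \<le> qform k M (homog k z)"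
  have "closed {x. 0 \<le> qform k M x}"
    unfolding qform_def by (intro closed_Collect_le continuous_intros continuous_on_product_coordinates)
  moreover have "0 \<le> qform k M x" if x: "x \<in> vecs k" "0 < x 1"
    "(\<lambda>i. if i \<in> {1..k-1} then x (i+1) / x 1 else 0) \<in> F" for x
  proof -
    define z t where "z = (\<lambda>i. if i \<in> {1..k-1} then x (i+1) / x 1 else 0)" and "t = x 1"
    have x_eq: "x a = t * homog k z a" if "a \<in> {1..k}" for a
    proof (cases "a = 1")
      case False
      then have "a \<in> {2..k}" "a - 1 \<in> {1..k - 1}" "a - 1 + 1 = a" using that by auto
      then show ?thesis using x(2) False by (simp add: homog_def z_def t_def)
    qed (simp add: homog_def t_def)
    have "qform k M x = (\<Sum>a=1..k. \<Sum>b=1..k. t\<^sup>2 * (homog k z a * M a b * homog k z b))"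
      unfolding qform_def by (intro sum.cong refl) (simp add: x_eq power2_eq_square mult_ac)
    also have "\<dots> = t\<^sup>2 * qform k M (homog k z)" by (simp add: qform_def sum_distrib_left)
    finally show ?thesis using pos x(3) unfolding z_def[symmetric] by simp
  qed
  ultimately have "persp k F \<subseteq> {x. 0 \<le> qform k M x}"
    unfolding persp_def by (intro closure_minimal subsetI CollectI) blast+
  then show "M \<in> COP k (persp k F)" unfolding COP_def using sym by blast
qed

lemma homog_1: "homog k z 1 = 1"
  by (simp add: homog_def)

lemma homog_blk:
  assumes "i \<in> {1..n}" "b * n + n + 1 \<le> k" shows "homog k z (1 + b * n + i) = blk n b z i"
  using assms by (auto simp: homog_def blk_def)

definition join_blks :: "nat \<Rightarrow> nat \<Rightarrow> (nat \<Rightarrow> vec) \<Rightarrow> vec" where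
  "join_blks n r f = (\<lambda>k. if k \<in> {1..r * n} then f ((k - 1) div n) ((k - 1) mod n + 1) else 0)"

lemma join_blks_vecs: "join_blks n r f \<in> vecs (r * n)"
  by (simp add: join_blks_def vecs_def)

lemma blk_join_blks:
  assumes "b < r" "i \<in> {1..n}" shows "blk n b (join_blks n r f) i = f b i"
proof -
  have "b * n + n \<le> r * n" using mult_le_mono1[of "Suc b" r n] assms(1) by simp
  then have "b * n + i \<in> {1..r * n}" using assms by auto
  moreover have "(b * n + i - 1) div n = b" "(b * n + i - 1) mod n + 1 = i"
  proof -
    obtain i' where "i = Suc i'" "i' < n" using assms by (cases i) auto
    then show "(b * n + i - 1) div n = b" "(b * n + i - 1) mod n + 1 = i" by simp_all
  qed
  ultimately show ?thesis using assms unfolding blk_def join_blks_def by simp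
qed

section \<open>Rounding to binary values\<close>

definition round01 :: "real \<Rightarrow> real" where
  "round01 t = (if t \<le> 1 / 2 then 0 else 1)"

lemma round01_cases: "round01 t = 0 \<or> round01 t = 1"
  by (simp add: round01_def)

text \<open>Preserving order is what keeps the difference of two separately rounded parts within the
  admissible binary range.\<close>

lemma round01_mono: "t \<le> u \<Longrightarrow> round01 t \<le> round01 u"
  by (simp add: round01_def)

text \<open>The left side is the smaller of \<open>t\<close> and \<open>1 - t\<close>, and the other
  factor is at least 1/2; this is where the factor 2 in the multipliers originates.\<close>

lemma round01_penalty:
  assumes "0 \<le> t" "t \<le> 1" shows "\<bar>t - round01 t\<bar> \<le> 2 * (t * (1 - t))"
proof (cases "t \<le> 1 / 2")
  case True
  then have "t * 1 \<le> t * (2 * (1 - t))" using assms by (intro mult_left_mono) auto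
  then show ?thesis using True assms by (simp add: round01_def algebra_simps)
next
  case False
  then have "(1 - t) * 1 \<le> (1 - t) * (2 * t)" using assms by (intro mult_left_mono) auto
  then show ?thesis using False assms by (simp add: round01_def algebra_simps)
qed

lemma ent_sym: "ent a b v r q = ent a b v q r"
  by (auto simp: ent_def)

section \<open>The constraint matrices evaluated at t = 1\<close>

definition cop_mat1 :: "nat \<Rightarrow> vec \<Rightarrow> real \<Rightarrow> vec \<Rightarrow> real \<Rightarrow> vec \<Rightarrow> vec \<Rightarrow> mat" where
  "cop_mat1 n mh \<rho> s \<beta> \<psi> \<phi> = (\<lambda>r q. \<beta> * outer (basis 1) (basis 1) r q
     + (\<Sum>i=1..n. \<psi> i * Mm n i r q) + (\<Sum>i=1..n. \<phi> i * Jm n i r q) - G1 n mh \<rho> s r q)"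

definition cop_mat2 :: "nat \<Rightarrow> vec \<Rightarrow> vec \<Rightarrow> real \<Rightarrow> vec \<Rightarrow> real \<Rightarrow> vec \<Rightarrow> mat" where
  "cop_mat2 n mh lh \<rho> s \<beta> \<psi> = (\<lambda>r q. \<beta> * outer (basis 1) (basis 1) r q
     + (\<Sum>i=1..n. \<psi> i * Nm n i r q) - G2 n mh lh \<rho> s r q)"

lemma Mm_sym: "Mm n i a b = Mm n i b a"
  by (simp add: Mm_def outer_def Let_def algebra_simps)

lemma Jm_sym: "Jm n i a b = Jm n i b a"
  by (simp add: Jm_def outer_def Let_def algebra_simps)

lemma Nm_sym: "Nm n i a b = Nm n i b a"
  by (simp add: Nm_def outer_def Let_def algebra_simps)

lemma cop_mat1_sym: "cop_mat1 n mh \<rho> s \<beta> \<psi> \<phi> a b = cop_mat1 n mh \<rho> s \<beta> \<psi> \<phi> b a"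
  unfolding cop_mat1_def G1_def Mm_sym[of _ _ a b] Jm_sym[of _ _ a b] ent_sym[of _ _ _ a b]
  by (simp add: outer_def)

lemma cop_mat2_sym: "cop_mat2 n mh lh \<rho> s \<beta> \<psi> a b = cop_mat2 n mh lh \<rho> s \<beta> \<psi> b a"
  unfolding cop_mat2_def G2_def Nm_sym[of _ _ a b] ent_sym[of _ _ _ a b]
  by (simp add: outer_def)

lemma qform_binary:
  assumes "1 \<le> k" "a \<in> {1..k}"
  shows "qform k (\<lambda>r q. outer (basis a) (basis a) r q - 1/2 * outer (basis a) (basis 1) r q
     - 1/2 * outer (basis 1) (basis a) r q) x = (x a)\<^sup>2 - x a * x 1"
  using assms by (simp only: qform_diff qform_scale qform_outer_basis atLeastAtMost_iff order_refl simp_thms)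
    (simp add: power2_eq_square mult_ac)

text \<open>At t = 1 the copositive constraint reads as a Lagrangian bound: the binary matrices give
  terms that vanish at 0 and 1 and are negative in between, and the transport cost is linear in the
  split parts.\<close>

lemma qform_cop_mat1:
  fixes z :: vec
  assumes "mp = blk n 0 z" "mm = blk n 1 z" "lp = blk n 2 z" "lm = blk n 3 z" "y = blk n 4 z"
  shows "qform (5*n+1) (cop_mat1 n mh \<rho> s \<beta> \<psi> \<phi>) (homog (5*n+1) z) =
    \<beta> + (\<Sum>i=1..n. \<psi> i * ((lm i)\<^sup>2 - lm i)) + (\<Sum>i=1..n. \<phi> i * ((lp i)\<^sup>2 - lp i))
    - (\<Sum>i=1..n. (mp i - mm i + mh i - s i) * y i - \<rho> * (mp i + mm i + lp i + lm i))"
proof -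
  let ?x = "homog (5*n+1) z" and ?k = "5*n+1"
  have x: "?x (1+i) = mp i" "?x (1+n+i) = mm i" "?x (1+2*n+i) = lp i" "?x (1+3*n+i) = lm i" "?x (1+4*n+i) = y i"
    if "i \<in> {1..n}" for i
    using homog_blk[OF that, of 0 ?k z] homog_blk[OF that, of 1 ?k z] homog_blk[OF that, of 2 ?k z]
      homog_blk[OF that, of 3 ?k z] homog_blk[OF that, of 4 ?k z] assms by auto
  have M: "qform ?k (Mm n i) ?x = (lm i)\<^sup>2 - lm i" if "i \<in> {1..n}" for i
    unfolding Mm_def Let_def using that x[OF that]
    by (subst qform_binary) (auto simp: homog_1 simp del: One_nat_def)
  have J: "qform ?k (Jm n i) ?x = (lp i)\<^sup>2 - lp i" if "i \<in> {1..n}" for i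
    unfolding Jm_def Let_def using that x[OF that]
    by (subst qform_binary) (auto simp: homog_1 simp del: One_nat_def)
  have half: "2 * (a / 2) = a" for a :: real by simp
  have G: "qform ?k (G1 n mh \<rho> s) ?x =
      (\<Sum>i=1..n. (mp i - mm i + mh i - s i) * y i - \<rho> * (mp i + mm i + lp i + lm i))"
    unfolding G1_def qform_sum[OF finite_atLeastAtMost]
  proof (rule sum.cong[OF refl])
    fix i assume i: "i \<in> {1..n}"
    then have idx: "1 \<in> {1..?k}" "1+i \<in> {1..?k}" "1+n+i \<in> {1..?k}" "1+2*n+i \<in> {1..?k}"
      "1+3*n+i \<in> {1..?k}" "1+4*n+i \<in> {1..?k}" by auto
    have neq: "1 \<noteq> 1 + i" "1 \<noteq> 1+n+i" "1 \<noteq> 1+2*n+i" "1 \<noteq> 1+3*n+i" "1 \<noteq> 1+4*n+i"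
      "1+i \<noteq> 1+4*n+i" "1+n+i \<noteq> 1+4*n+i" using i by auto
    show "qform ?k (\<lambda>r q. ent 1 (1+i) (-\<rho>/2) r q + ent 1 (1+n+i) (-\<rho>/2) r q
       + ent 1 (1+2*n+i) (-\<rho>/2) r q + ent 1 (1+3*n+i) (-\<rho>/2) r q
       + ent 1 (1+4*n+i) ((mh i - s i) / 2) r q
       + ent (1+i) (1+4*n+i) (1/2) r q + ent (1+n+i) (1+4*n+i) (-1/2) r q) ?x
      = (mp i - mm i + mh i - s i) * y i - \<rho> * (mp i + mm i + lp i + lm i)"
      unfolding qform_add qform_ent[OF idx(1) idx(2)] qform_ent[OF idx(1) idx(3)] qform_ent[OF idx(1) idx(4)]
        qform_ent[OF idx(1) idx(5)] qform_ent[OF idx(1) idx(6)] qform_ent[OF idx(2) idx(6)]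
        qform_ent[OF idx(3) idx(6)] x[OF i] homog_1 if_not_P[OF neq(1)] if_not_P[OF neq(2)]
        if_not_P[OF neq(3)] if_not_P[OF neq(4)] if_not_P[OF neq(5)] if_not_P[OF neq(6)] if_not_P[OF neq(7)]
        half
      by (simp add: algebra_simps)
  qed
  have e: "qform ?k (outer (basis 1) (basis 1)) ?x = 1"
    by (subst qform_outer_basis) (auto simp: homog_1 simp del: One_nat_def)
  show ?thesis
    unfolding cop_mat1_def qform_add qform_diff qform_scale qform_sum[OF finite_atLeastAtMost] e G
    using M J by simp
qed

text \<open>The \<rho>-terms of \<open>G2\<close> are the expanded square of the distance to the
  data point, so for p = 2 the transport cost is quadratic in the scenario itself.\<close>

lemma qform_cop_mat2:
  fixes z :: vec
  assumes "m = blk n 0 z" "l = blk n 1 z" "y = blk n 2 z"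
  shows "qform (3*n+1) (cop_mat2 n mh lh \<rho> s \<beta> \<psi>) (homog (3*n+1) z) =
    \<beta> + (\<Sum>i=1..n. \<psi> i * ((l i)\<^sup>2 - l i))
    - ((\<Sum>i=1..n. (m i - s i) * y i) - \<rho> * costp n 2 (m, l) (mh, lh))"
proof -
  let ?x = "homog (3*n+1) z" and ?k = "3*n+1"
  have x: "?x (1+i) = m i" "?x (1+n+i) = l i" "?x (1+2*n+i) = y i"
    if "i \<in> {1..n}" for i
    using homog_blk[OF that, of 0 ?k z] homog_blk[OF that, of 1 ?k z] homog_blk[OF that, of 2 ?k z] assms by auto
  have M: "qform ?k (Nm n i) ?x = (l i)\<^sup>2 - l i" if "i \<in> {1..n}" for i
    unfolding Nm_def Let_def using that x[OF that]
    by (subst qform_binary) (auto simp: homog_1 simp del: One_nat_def)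
  have one: "1 \<in> {1..?k}" by simp
  have G: "qform ?k (G2 n mh lh \<rho> s) ?x = - \<rho> * ((\<Sum>i=1..n. (mh i)\<^sup>2) + (\<Sum>i=1..n. (lh i)\<^sup>2))
      + (\<Sum>i=1..n. 2 * (\<rho> * mh i) * m i + 2 * (\<rho> * lh i) * l i - s i * y i - \<rho> * (m i)\<^sup>2 - \<rho> * (l i)\<^sup>2 + m i * y i)"
    unfolding G2_def qform_add[of ?k "ent 1 1 _"] qform_sum[OF finite_atLeastAtMost] qform_ent[OF one one] homog_1
  proof (intro arg_cong2[where f="(+)"] sum.cong refl)
    fix i assume i: "i \<in> {1..n}"
    then have idx: "1+i \<in> {1..?k}" "1+n+i \<in> {1..?k}" "1+2*n+i \<in> {1..?k}" by auto
    have neq: "1 \<noteq> 1 + i" "1 \<noteq> 1+n+i" "1 \<noteq> 1+2*n+i" "1+i \<noteq> 1+2*n+i" using i by auto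
    show "qform ?k (\<lambda>r q. ent 1 (1+i) (\<rho> * mh i) r q + ent 1 (1+n+i) (\<rho> * lh i) r q
         + ent 1 (1+2*n+i) (- s i / 2) r q
         + ent (1+i) (1+i) (-\<rho>) r q + ent (1+n+i) (1+n+i) (-\<rho>) r q
         + ent (1+i) (1+2*n+i) (1/2) r q) ?x
      = 2 * (\<rho> * mh i) * m i + 2 * (\<rho> * lh i) * l i - s i * y i - \<rho> * (m i)\<^sup>2 - \<rho> * (l i)\<^sup>2 + m i * y i"
      unfolding qform_add qform_ent[OF one idx(1)] qform_ent[OF one idx(2)] qform_ent[OF one idx(3)]
        qform_ent[OF idx(1) idx(1)] qform_ent[OF idx(2) idx(2)] qform_ent[OF idx(1) idx(3)]
        x[OF i] homog_1 if_not_P[OF neq(1)] if_not_P[OF neq(2)] if_not_P[OF neq(3)] if_not_P[OF neq(4)] if_P[OF refl]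
      by (simp add: algebra_simps)
  qed simp
  have e: "qform ?k (outer (basis 1) (basis 1)) ?x = 1"
    by (subst qform_outer_basis) (auto simp: homog_1 simp del: One_nat_def)
  have c: "costp n 2 (m, l) (mh, lh) = (\<Sum>i=1..n. (m i)\<^sup>2 - 2 * mh i * m i + (l i)\<^sup>2 - 2 * lh i * l i)
      + (\<Sum>i=1..n. (mh i)\<^sup>2) + (\<Sum>i=1..n. (lh i)\<^sup>2)"
    unfolding costp_def fst_conv snd_conv power2_abs sum.distrib[symmetric]
    by (intro sum.cong refl) (simp add: power2_eq_square algebra_simps)
  have "(\<Sum>i=1..n. 2 * (\<rho> * mh i) * m i + 2 * (\<rho> * lh i) * l i - s i * y i - \<rho> * (m i)\<^sup>2 - \<rho> * (l i)\<^sup>2 + m i * y i)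
    = (\<Sum>i=1..n. (m i - s i) * y i) - \<rho> * (\<Sum>i=1..n. (m i)\<^sup>2 - 2 * mh i * m i + (l i)\<^sup>2 - 2 * lh i * l i)"
    unfolding sum_distrib_left sum_subtractf[symmetric] by (intro sum.cong refl) (simp add: algebra_simps)
  then have "qform ?k (G2 n mh lh \<rho> s) ?x = (\<Sum>i=1..n. (m i - s i) * y i) - \<rho> * costp n 2 (m, l) (mh, lh)"
    unfolding G c by (simp only: distrib_left)
  moreover have "(\<Sum>i=1..n. \<psi> i * qform ?k (Nm n i) ?x) = (\<Sum>i=1..n. \<psi> i * ((l i)\<^sup>2 - l i))"
    by (intro sum.cong refl) (simp only: M)
  ultimately show ?thesis
    unfolding cop_mat2_def qform_add qform_diff qform_scale qform_sum[OF finite_atLeastAtMost] e by simp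
qed

section \<open>The copositive reformulation\<close>

context no_show
begin

lemma F1_subset: "F1 n K uL uU C c d mh lh \<subseteq> vecs (5*n+1 - 1)"
  by (auto simp: F1_def)

lemma F2_subset: "F2 n K uL uU C c d \<subseteq> vecs (3*n+1 - 1)"
  by (auto simp: F2_def)

text \<open>A genuine scenario lifts to a point whose \<lambda>-parts are binary, so the penalty
  terms vanish whatever the signs of \<psi> and \<phi>.\<close>

lemma COP_imp_dual_bound1:
  assumes s: "s \<in> vecs n" and hat: "(mh, lh) \<in> Xi n K uL uU" and x: "x \<in> Xi n K uL uU"
    and cop: "cop_mat1 n mh \<rho> s \<beta> \<psi> \<phi> \<in> COP (5*n+1) (K1 n K uL uU C c d mh lh)"
  shows "gval n c d C s x - \<rho> * costp n 1 x (mh, lh) \<le> \<beta>"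
proof -
  obtain m l where x_eq: "x = (m, l)" by (cases x)
  have ml: "(m, l) \<in> Xi n K uL uU" using x x_eq by simp
  obtain y where y: "relaxed m l y" "gval n c d C s (m, l) = (\<Sum>i=1..n. (m i - s i) * y i)"
    by (rule gval_dual[OF ml s])
  \<comment> \<open>Positive and negative parts of the displacement: with this split the linear cost
    equals the absolute values exactly.\<close>
  define f :: "nat \<Rightarrow> vec" where "f = (\<lambda>b. [\<lambda>i. max (m i - mh i) 0, \<lambda>i. max (mh i - m i) 0,
    \<lambda>i. max (l i - lh i) 0, \<lambda>i. max (lh i - l i) 0, y] ! b)"
  define z where "z = join_blks n 5 f"
  have z: "blk n 0 z i = max (m i - mh i) 0" "blk n 1 z i = max (mh i - m i) 0" "blk n 2 z i = max (l i - lh i) 0"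
    "blk n 3 z i = max (lh i - l i) 0" "blk n 4 z i = y i" if "i \<in> {1..n}" for i
    unfolding z_def using that by (simp_all add: blk_join_blks f_def del: One_nat_def)
  have lam: "blk n 2 z i - blk n 3 z i + lh i = l i" "blk n 0 z i - blk n 1 z i + mh i = m i" if "i \<in> {1..n}" for i
    unfolding z[OF that] by auto
  have yY: "- y i \<le> d i" if "i \<in> {1..n}" for i using y(1) that by (simp add: relaxed_def Ycal_def)
  have ys: "y (i - 1) - y i \<le> c i * l i" if "i \<in> {2..n}" for i
    using y(1) that by (simp add: relaxed_def Ycal_def)
  have yC: "y n \<le> C" using y(1) by (simp add: relaxed_def Ycal_def)
  have lb: "l i = 0 \<or> l i = 1" "lh i = 0 \<or> lh i = 1" if "i \<in> {1..n}" for i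
    using XiD(3)[OF ml that] XiD(3)[OF hat that] by auto
  have "(\<Sum>i=1..n. 1 - (blk n 2 z i - blk n 3 z i + lh i)) = (\<Sum>i=1..n. 1 - l i)"
    by (intro sum.cong refl) (simp add: lam)
  then have sK: "(\<Sum>i=1..n. 1 - (blk n 2 z i - blk n 3 z i + lh i)) \<le> real K"
    using XiD(5)[OF ml] by simp
  have "z \<in> F1 n K uL uU C c d mh lh"
    unfolding F1_def Let_def
  proof (intro CollectI conjI ballI sK)
    show "z \<in> vecs (5*n)" unfolding z_def by (rule join_blks_vecs)
    fix i assume i: "i \<in> {1..n}"
    show "0 \<le> blk n 0 z i" "0 \<le> blk n 1 z i" "0 \<le> blk n 2 z i" "0 \<le> blk n 3 z i" unfolding z[OF i] by auto
    show "blk n 2 z i \<le> 1" "blk n 3 z i \<le> 1" unfolding z[OF i] using lb[OF i] by auto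
    show "0 \<le> blk n 2 z i - blk n 3 z i + lh i" "blk n 2 z i - blk n 3 z i + lh i \<le> 1"
      "uL i * (blk n 2 z i - blk n 3 z i + lh i) \<le> blk n 0 z i - blk n 1 z i + mh i"
      "blk n 0 z i - blk n 1 z i + mh i \<le> uU i * (blk n 2 z i - blk n 3 z i + lh i)"
      unfolding lam[OF i] using XiD(4)[OF ml i] by auto
    show "- blk n 4 z i \<le> d i" unfolding z[OF i] by (rule yY[OF i])
  next
    show "blk n 4 z n \<le> C" using z(5)[of n] n_pos yC by simp
    fix i assume i: "i \<in> {2..n}"
    then have i': "i \<in> {1..n}" "i - 1 \<in> {1..n}" by auto
    show "blk n 4 z (i - 1) - blk n 4 z i \<le> c i * (blk n 2 z i - blk n 3 z i + lh i)"
      unfolding z(5)[OF i'(1)] z(5)[OF i'(2)] lam[OF i'(1)] by (rule ys[OF i])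
  qed
  then have "0 \<le> qform (5*n+1) (cop_mat1 n mh \<rho> s \<beta> \<psi> \<phi>) (homog (5*n+1) z)"
    using cop unfolding K1_def by (subst (asm) COP_persp_iff[OF _ F1_subset cop_mat1_sym]) auto
  also have "\<dots> = \<beta> - (\<Sum>i=1..n. (m i - s i) * y i - \<rho> * (\<bar>m i - mh i\<bar> + \<bar>l i - lh i\<bar>))"
  proof -
    have "(blk n 3 z i)\<^sup>2 - blk n 3 z i = 0" "(blk n 2 z i)\<^sup>2 - blk n 2 z i = 0" if "i \<in> {1..n}" for i
      unfolding z[OF that] using lb[OF that] by auto
    then have "(\<Sum>i=1..n. \<psi> i * ((blk n 3 z i)\<^sup>2 - blk n 3 z i)) = 0"
      "(\<Sum>i=1..n. \<phi> i * ((blk n 2 z i)\<^sup>2 - blk n 2 z i)) = 0" by simp_all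
    moreover have "(\<Sum>i=1..n. (blk n 0 z i - blk n 1 z i + mh i - s i) * blk n 4 z i
        - \<rho> * (blk n 0 z i + blk n 1 z i + blk n 2 z i + blk n 3 z i))
      = (\<Sum>i=1..n. (m i - s i) * y i - \<rho> * (\<bar>m i - mh i\<bar> + \<bar>l i - lh i\<bar>))"
    proof (intro sum.cong refl)
      fix i assume i: "i \<in> {1..n}"
      have "blk n 0 z i + blk n 1 z i + blk n 2 z i + blk n 3 z i = \<bar>m i - mh i\<bar> + \<bar>l i - lh i\<bar>"
        unfolding z[OF i] by auto
      then show "(blk n 0 z i - blk n 1 z i + mh i - s i) * blk n 4 z i
        - \<rho> * (blk n 0 z i + blk n 1 z i + blk n 2 z i + blk n 3 z i)
        = (m i - s i) * y i - \<rho> * (\<bar>m i - mh i\<bar> + \<bar>l i - lh i\<bar>)"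
        by (simp only: lam[OF i] z(5)[OF i])
    qed
    ultimately show ?thesis unfolding qform_cop_mat1[OF refl refl refl refl refl] by simp
  qed
  finally show ?thesis
    unfolding x_eq y(2) costp_def by (simp add: sum_subtractf sum_distrib_left)
qed

text \<open>Forgetting the split turns a point of \<open>F1\<close> into a relaxed triple, to which
  the exact penalty applies; the distance to a rounded vector is then paid for by the penalties on
  both parts.\<close>

lemma dual_bound_imp_COP1:
  assumes s: "s \<in> vecs n" and \<rho>: "0 \<le> \<rho>" and hat: "(mh, lh) \<in> Xi n K uL uU"
    and B: "\<And>x. x \<in> Xi n K uL uU \<Longrightarrow> gval n c d C s x - \<rho> * costp n 1 x (mh, lh) \<le> \<beta>"
  shows "\<exists>L. cop_mat1 n mh \<rho> s \<beta> (\<lambda>_. L) (\<lambda>_. L) \<in> COP (5*n+1) (K1 n K uL uU C c d mh lh)"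
proof -
  obtain L where L: "0 \<le> L" "\<And>m l y l0. relaxed m l y \<Longrightarrow> (\<And>i. i \<in> {1..n} \<Longrightarrow> l0 i = 0 \<or> l0 i = 1) \<Longrightarrow>
      (\<Sum>i=1..n. (m i - s i) * y i) - \<rho> * costp n 1 (m, l) (mh, lh) \<le> \<beta> + L * (\<Sum>i=1..n. \<bar>l i - l0 i\<bar>)"
    by (rule exact_penalty[where p=1 and B=\<beta>, OF s \<rho> order_refl hat]) (rule B, assumption, blast)
  \<comment> \<open>The minus sign makes the penalty nonnegative, as \<open>t^2 - t\<close> is at
    most 0 on [0,1]; the 2 comes from the rounding estimate.\<close>
  have "0 \<le> qform (5*n+1) (cop_mat1 n mh \<rho> s \<beta> (\<lambda>_. - (2 * L)) (\<lambda>_. - (2 * L))) (homog (5*n+1) z)"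
    if zF: "z \<in> F1 n K uL uU C c d mh lh" for z
  proof -
    define mp mm lp lm y where "mp = blk n 0 z" and "mm = blk n 1 z" and "lp = blk n 2 z"
      and "lm = blk n 3 z" and "y = blk n 4 z"
    define l m where "l = (\<lambda>i. lp i - lm i + lh i)" and "m = (\<lambda>i. mp i - mm i + mh i)"
    have zz: "0 \<le> mp i" "0 \<le> mm i" "0 \<le> lp i" "0 \<le> lm i" "0 \<le> l i" "l i \<le> 1" "lp i \<le> 1" "lm i \<le> 1"
      "uL i * l i \<le> m i" "m i \<le> uU i * l i" "- y i \<le> d i" if "i \<in> {1..n}" for i
      using zF that by (auto simp: F1_def Let_def mp_def mm_def lp_def lm_def y_def l_def m_def)
    have zK: "(\<Sum>i=1..n. 1 - l i) \<le> real K" and zC: "y n \<le> C"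
      and zs: "\<And>i. i \<in> {2..n} \<Longrightarrow> y (i - 1) - y i \<le> c i * l i"
      using zF by (auto simp: F1_def Let_def lp_def lm_def y_def l_def)
    have "y \<in> vecs n" by (auto simp: y_def blk_def vecs_def)
    then have r: "relaxed m l y" using zz zK zC zs by (simp add: relaxed_def Ycal_def)
    define l0 where "l0 = (\<lambda>i. round01 (lp i) - round01 (lm i) + lh i)"
    \<comment> \<open>If \<open>lh i = 0\<close>, then \<open>l i \<ge> 0\<close> says
      \<open>lm i \<le> lp i\<close>; if \<open>lh i = 1\<close>, then \<open>l i \<le> 1\<close>
      says the opposite. Monotone rounding keeps that order and excludes the values -1 and
      2.\<close>
    have l0: "l0 i = 0 \<or> l0 i = 1" if i: "i \<in> {1..n}" for i
    proof (cases "lh i = 0")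
      case True
      then have "round01 (lm i) \<le> round01 (lp i)" using zz(5)[OF i] by (intro round01_mono) (simp add: l_def)
      then show ?thesis using True round01_cases[of "lp i"] round01_cases[of "lm i"] by (auto simp: l0_def)
    next
      case False
      then have lh: "lh i = 1" using XiD(3)[OF hat i] by auto
      then have "round01 (lp i) \<le> round01 (lm i)" using zz(6)[OF i] by (intro round01_mono) (simp add: l_def)
      then show ?thesis using lh round01_cases[of "lp i"] round01_cases[of "lm i"] by (auto simp: l0_def)
    qed
    have dist: "\<bar>l i - l0 i\<bar> \<le> 2 * (lp i * (1 - lp i)) + 2 * (lm i * (1 - lm i))" if i: "i \<in> {1..n}" for i
      using round01_penalty[of "lp i"] round01_penalty[of "lm i"] zz[OF i] by (simp add: l_def l0_def)
    \<comment> \<open>Both parts may be positive, so the split cost only dominates the distance;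
      with \<rho> \<ge> 0 this is the favourable direction.\<close>
    have "costp n 1 (m, l) (mh, lh) \<le> (\<Sum>i=1..n. mp i + mm i + lp i + lm i)"
      unfolding costp_def
    proof (rule sum_mono)
      fix i assume i: "i \<in> {1..n}"
      show "\<bar>fst (m, l) i - fst (mh, lh) i\<bar> ^ 1 + \<bar>snd (m, l) i - snd (mh, lh) i\<bar> ^ 1 \<le> mp i + mm i + lp i + lm i"
        using zz[OF i] by (simp add: m_def l_def)
    qed
    then have "(\<Sum>i=1..n. (m i - s i) * y i) - \<rho> * (\<Sum>i=1..n. mp i + mm i + lp i + lm i)
        \<le> (\<Sum>i=1..n. (m i - s i) * y i) - \<rho> * costp n 1 (m, l) (mh, lh)"
      using \<rho> by (intro diff_left_mono mult_left_mono) auto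
    also have "\<dots> \<le> \<beta> + L * (\<Sum>i=1..n. \<bar>l i - l0 i\<bar>)"
      by (rule L(2)[OF r l0])
    also have "\<dots> \<le> \<beta> + L * (\<Sum>i=1..n. 2 * (lp i * (1 - lp i)) + 2 * (lm i * (1 - lm i)))"
      using L(1) dist by (intro add_left_mono mult_left_mono sum_mono) auto
    also have "\<dots> = \<beta> + (\<Sum>i=1..n. - (2 * L) * ((lm i)\<^sup>2 - lm i)) + (\<Sum>i=1..n. - (2 * L) * ((lp i)\<^sup>2 - lp i))"
      unfolding add.assoc sum.distrib[symmetric] sum_distrib_left
      by (intro arg_cong2[where f="(+)"] sum.cong refl) (simp add: power2_eq_square algebra_simps)
    finally have "(\<Sum>i=1..n. (m i - s i) * y i - \<rho> * (mp i + mm i + lp i + lm i))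
        \<le> \<beta> + (\<Sum>i=1..n. - (2 * L) * ((lm i)\<^sup>2 - lm i)) + (\<Sum>i=1..n. - (2 * L) * ((lp i)\<^sup>2 - lp i))"
      by (simp only: sum_subtractf sum_distrib_left)
    then show ?thesis
      unfolding qform_cop_mat1[OF mp_def mm_def lp_def lm_def y_def] m_def by simp
  qed
  then show ?thesis
    unfolding K1_def by (subst COP_persp_iff[OF _ F1_subset cop_mat1_sym]) auto
qed

lemma COP_imp_dual_bound2:
  assumes s: "s \<in> vecs n" and x: "x \<in> Xi n K uL uU"
    and cop: "cop_mat2 n mh lh \<rho> s \<beta> \<psi> \<in> COP (3*n+1) (K2 n K uL uU C c d)"
  shows "gval n c d C s x - \<rho> * costp n 2 x (mh, lh) \<le> \<beta>"
proof -
  obtain m l where x_eq: "x = (m, l)" by (cases x)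
  have ml: "(m, l) \<in> Xi n K uL uU" using x x_eq by simp
  obtain y where y: "relaxed m l y" "gval n c d C s (m, l) = (\<Sum>i=1..n. (m i - s i) * y i)"
    by (rule gval_dual[OF ml s])
  define z where "z = join_blks n 3 (\<lambda>b. [m, l, y] ! b)"
  have z': "blk n 0 z i = m i" "blk n 1 z i = l i" "blk n 2 z i = y i" if "i \<in> {1..n}" for i
    unfolding z_def using that by (simp_all add: blk_join_blks del: One_nat_def)
  have "y \<in> vecs n" using y(1) by (simp add: relaxed_def Ycal_def)
  then have z: "blk n 0 z = m" "blk n 1 z = l" "blk n 2 z = y"
    using z' XiD(1,2)[OF ml] by (auto simp: fun_eq_iff blk_def vecs_def simp del: One_nat_def)
  have "z \<in> F2 n K uL uU C c d"
    unfolding F2_def Let_def mem_Collect_eq z using y(1) by (simp add: relaxed_def z_def join_blks_vecs)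
  then have "0 \<le> qform (3*n+1) (cop_mat2 n mh lh \<rho> s \<beta> \<psi>) (homog (3*n+1) z)"
    using cop unfolding K2_def by (subst (asm) COP_persp_iff[OF _ F2_subset cop_mat2_sym]) auto
  moreover have "(\<Sum>i=1..n. \<psi> i * ((l i)\<^sup>2 - l i)) = 0"
    by (intro sum.neutral ballI) (use XiD(3)[OF ml] in fastforce)
  ultimately show ?thesis unfolding x_eq y(2) qform_cop_mat2[OF refl refl refl] z by simp
qed

text \<open>Here \<open>l\<close> itself is rounded to a nearest binary vector. That vector may
  violate the no-show budget, a case the exact penalty already includes.\<close>

lemma dual_bound_imp_COP2:
  assumes s: "s \<in> vecs n" and \<rho>: "0 \<le> \<rho>" and hat: "(mh, lh) \<in> Xi n K uL uU"
    and B: "\<And>x. x \<in> Xi n K uL uU \<Longrightarrow> gval n c d C s x - \<rho> * costp n 2 x (mh, lh) \<le> \<beta>"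
  shows "\<exists>L. cop_mat2 n mh lh \<rho> s \<beta> (\<lambda>_. L) \<in> COP (3*n+1) (K2 n K uL uU C c d)"
proof -
  obtain L where L: "0 \<le> L" "\<And>m l y l0. relaxed m l y \<Longrightarrow> (\<And>i. i \<in> {1..n} \<Longrightarrow> l0 i = 0 \<or> l0 i = 1) \<Longrightarrow>
      (\<Sum>i=1..n. (m i - s i) * y i) - \<rho> * costp n 2 (m, l) (mh, lh) \<le> \<beta> + L * (\<Sum>i=1..n. \<bar>l i - l0 i\<bar>)"
    by (rule exact_penalty[where p=2 and B=\<beta>, OF s \<rho> one_le_numeral hat]) (rule B, assumption, blast)
  have "0 \<le> qform (3*n+1) (cop_mat2 n mh lh \<rho> s \<beta> (\<lambda>_. - (2 * L))) (homog (3*n+1) z)"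
    if zF: "z \<in> F2 n K uL uU C c d" for z
  proof -
    define m l y where "m = blk n 0 z" and "l = blk n 1 z" and "y = blk n 2 z"
    have r: "relaxed m l y" using zF by (auto simp: F2_def Let_def m_def l_def y_def relaxed_def)
    have "(\<Sum>i=1..n. (m i - s i) * y i) - \<rho> * costp n 2 (m, l) (mh, lh)
        \<le> \<beta> + L * (\<Sum>i=1..n. \<bar>l i - round01 (l i)\<bar>)"
      by (rule L(2)[OF r round01_cases])
    also have "\<dots> \<le> \<beta> + L * (\<Sum>i=1..n. 2 * (l i * (1 - l i)))"
      using L(1) r by (intro add_left_mono mult_left_mono sum_mono round01_penalty) (auto simp: relaxed_def)
    also have "\<dots> = \<beta> + (\<Sum>i=1..n. - (2 * L) * ((l i)\<^sup>2 - l i))"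
      unfolding sum_distrib_left
      by (intro arg_cong2[where f="(+)"] sum.cong refl) (simp add: power2_eq_square algebra_simps)
    finally show ?thesis
      unfolding qform_cop_mat2[OF m_def l_def y_def] by simp
  qed
  then show ?thesis
    unfolding K2_def by (subst COP_persp_iff[OF _ F2_subset cop_mat2_sym]) auto
qed

section \<open>The worst-case expectation as an attained dual value\<close>

lemma wns_obj_le:
  assumes s: "s \<in> vecs n" and "1 \<le> p" "1 \<le> N" "0 < \<epsilon>" "0 \<le> \<rho>"
    and dual: "\<And>x j. x \<in> Xi n K uL uU \<Longrightarrow> j \<in> {1..N} \<Longrightarrow>
      gval n c d C s x - \<rho> * costp n p x (muh j, lamh j) \<le> \<beta> j"
  shows "wns_obj n T c d C uL uU K p N muh lamh \<epsilon> s \<le> ereal (\<epsilon> ^ p * \<rho> + 1 / real N * (\<Sum>j=1..N. \<beta> j))"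
proof -
  obtain H where H: "\<And>x. x \<in> Xi n K uL uU \<Longrightarrow> \<bar>gval n c d C s x\<bar> \<le> H"
    by (rule gval_bounded[OF s]) blast
  show ?thesis unfolding wns_obj_def
  proof (rule SUP_least)
    fix Q assume Q: "Q \<in> amb n K uL uU p N muh lamh \<epsilon>"
    have "(\<integral>x. gval n c d C s x \<partial>Q) \<le> \<epsilon> ^ p * \<rho> + 1 / real N * (\<Sum>j=1..N. \<beta> j)"
    proof (rule wasserstein_weak_duality[OF Q assms(2-5) gval_measurable H])
      fix x j assume "x \<in> Xi n K uL uU" "j \<in> {1..N}"
      from dual[OF this] show "gval n c d C s x \<le> \<rho> * costp n p x (muh j, lamh j) + \<beta> j" by simp
    qed assumption
    then show "ereal (\<integral>x. gval n c d C s x \<partial>Q) \<le> ereal (\<epsilon> ^ p * \<rho> + 1 / real N * (\<Sum>j=1..N. \<beta> j))"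
      by (simp only: ereal_less_eq)
  qed
qed

lemma wns_obj_attained:
  assumes s: "s \<in> vecs n" and "1 \<le> p" "1 \<le> N" "0 < \<epsilon>"
    and data: "\<And>j. j \<in> {1..N} \<Longrightarrow> (muh j, lamh j) \<in> Xi n K uL uU"
  obtains \<rho> \<beta> where "0 \<le> \<rho>"
    "\<And>x j. x \<in> Xi n K uL uU \<Longrightarrow> j \<in> {1..N} \<Longrightarrow>
      gval n c d C s x - \<rho> * costp n p x (muh j, lamh j) \<le> \<beta> j"
    "ereal (\<epsilon> ^ p * \<rho> + 1 / real N * (\<Sum>j=1..N. \<beta> j)) \<le> wns_obj n T c d C uL uU K p N muh lamh \<epsilon> s"
proof -
  let ?V = "wns_obj n T c d C uL uU K p N muh lamh \<epsilon> s" and ?g = "gval n c d C s"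
  obtain H where H: "\<And>x. x \<in> Xi n K uL uU \<Longrightarrow> \<bar>?g x\<bar> \<le> H"
    by (rule gval_bounded[OF s]) blast
  have strong: "\<exists>\<rho>\<ge>0. \<forall>x. (\<forall>j\<in>{1..N}. x j \<in> Xi n K uL uU) \<longrightarrow>
      \<epsilon> ^ p * \<rho> + 1 / real N * (\<Sum>j=1..N. ?g (x j) - \<rho> * costp n p (x j) (muh j, lamh j)) \<le> v"
    if "?V \<le> ereal v" for v
  proof -
    have "(\<integral>x. ?g x \<partial>Q) \<le> v" if "Q \<in> amb n K uL uU p N muh lamh \<epsilon>" for Q
    proof -
      have "ereal (\<integral>x. ?g x \<partial>Q) \<le> ?V" unfolding wns_obj_def using that by (rule SUP_upper)
      then have "ereal (\<integral>x. ?g x \<partial>Q) \<le> ereal v" using \<open>?V \<le> ereal v\<close> by (rule order_trans)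
      then show ?thesis by simp
    qed
    then show ?thesis
      by (rule wasserstein_strong_duality[OF _ assms(2-4) gval_measurable data]) (assumption+, blast)
  qed
  \<comment> \<open>The bound with \<rho> = 0 excludes plus infinity. Minus infinity would allow v =
    -1 in strong duality, contradicted by the plan that leaves all data in place, whose value is
    nonnegative.\<close>
  obtain v where v: "?V = ereal v"
  proof (cases ?V)
    case PInf
    have "?V \<le> ereal (\<epsilon> ^ p * 0 + 1 / real N * (\<Sum>j=1..N. H))"
      using H by (intro wns_obj_le s assms) (auto simp: abs_le_iff)
    with PInf show ?thesis by simp
  next
    case MInf
    then obtain \<rho> where \<rho>: "0 \<le> \<rho>"
      "\<epsilon> ^ p * \<rho> + 1 / real N * (\<Sum>j=1..N. ?g (muh j, lamh j) - \<rho> * costp n p (muh j, lamh j) (muh j, lamh j)) \<le> - 1"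
      using strong[of "- 1"] data by auto
    have "0 \<le> ?g (muh j, lamh j) - \<rho> * costp n p (muh j, lamh j) (muh j, lamh j)" if "j \<in> {1..N}" for j
    proof -
      have "costp n p (muh j, lamh j) (muh j, lamh j) = 0" using assms(2) by (simp add: costp_def)
      moreover have "0 \<le> ?g (muh j, lamh j)" using XiD(4)[OF data[OF that]] by (intro gval_nonneg) auto
      ultimately show ?thesis by simp
    qed
    then have "0 \<le> \<epsilon> ^ p * \<rho> + 1 / real N * (\<Sum>j=1..N. ?g (muh j, lamh j) - \<rho> * costp n p (muh j, lamh j) (muh j, lamh j))"
      using \<rho>(1) assms(4) by (intro add_nonneg_nonneg mult_nonneg_nonneg sum_nonneg) auto
    with \<rho>(2) show ?thesis by simp
  qed blast
  obtain \<rho> where \<rho>: "0 \<le> \<rho>" "\<And>x. (\<And>j. j \<in> {1..N} \<Longrightarrow> x j \<in> Xi n K uL uU) \<Longrightarrow>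
      \<epsilon> ^ p * \<rho> + 1 / real N * (\<Sum>j=1..N. ?g (x j) - \<rho> * costp n p (x j) (muh j, lamh j)) \<le> v"
    using strong[of v] v by auto
  define h where "h j x = ?g x - \<rho> * costp n p x (muh j, lamh j)" for j x
  define \<beta> where "\<beta> j = (SUP x\<in>Xi n K uL uU. h j x)" for j
  have bdd: "bdd_above (h j ` Xi n K uL uU)" for j
  proof (rule bdd_aboveI2[where M=H])
    fix x assume "x \<in> Xi n K uL uU"
    then show "h j x \<le> H" using H[of x] mult_nonneg_nonneg[OF \<rho>(1) costp_nonneg, of n p x] 
      by (simp add: h_def abs_le_iff) (smt (verit, best))
  qed
  \<comment> \<open>Near-maximisers chosen separately for each data point form one plan, so the
    bound on plans passes to the sum of the suprema.\<close>
  have "1 / real N * (\<Sum>j=1..N. \<beta> j) \<le> v - \<epsilon> ^ p * \<rho>"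
  proof (rule field_le_epsilon)
    fix e :: real assume e: "0 < e"
    have "\<exists>x\<in>Xi n K uL uU. \<beta> j - e < h j x" if "j \<in> {1..N}" for j
    proof -
      have "Xi n K uL uU \<noteq> {}" using data[OF that] by blast
      then show ?thesis using less_cSUP_iff[OF _ bdd, of "\<beta> j - e" j] e by (auto simp: \<beta>_def)
    qed
    then obtain x where x: "\<And>j. j \<in> {1..N} \<Longrightarrow> x j \<in> Xi n K uL uU \<and> \<beta> j - e < h j (x j)" by metis
    have "1 / real N * (\<Sum>j=1..N. \<beta> j) - e = 1 / real N * (\<Sum>j=1..N. \<beta> j - e)"
      using assms(3) by (simp add: sum_subtractf right_diff_distrib)
    also have "\<dots> \<le> 1 / real N * (\<Sum>j=1..N. h j (x j))"
      using x assms(3) by (intro mult_left_mono sum_mono less_imp_le) auto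
    also have "\<dots> \<le> v - \<epsilon> ^ p * \<rho>" using \<rho>(2)[of x] x by (simp add: h_def)
    finally show "1 / real N * (\<Sum>j=1..N. \<beta> j) \<le> v - \<epsilon> ^ p * \<rho> + e" by simp
  qed
  then have "ereal (\<epsilon> ^ p * \<rho> + 1 / real N * (\<Sum>j=1..N. \<beta> j)) \<le> ?V" by (simp add: v)
  moreover have "?g x - \<rho> * costp n p x (muh j, lamh j) \<le> \<beta> j" if "x \<in> Xi n K uL uU" for x j
    using cSUP_upper[OF that bdd, of j] unfolding \<beta>_def h_def .
  ultimately show ?thesis using that \<rho>(1) by blast
qed

end

text \<open>The hypothesis \<open>att\<close> asks for a feasible \<open>q\<close> attaining
  \<open>V s\<close> at every \<open>s\<close>, not merely in the limit; a minimiser of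
  \<open>V\<close> is thereby also part of an optimal pair, and \<open>le\<close> gives the
  converse.\<close>

lemma optima_coincide:
  fixes V :: "'s \<Rightarrow> ereal" and obj :: "'q \<Rightarrow> ereal"
  assumes le: "\<And>q s. feas q s \<Longrightarrow> s \<in> S \<and> V s \<le> obj q"
    and att: "\<And>s. s \<in> S \<Longrightarrow> \<exists>q. feas q s \<and> obj q \<le> V s"
  shows "(INF s\<in>S. V s) = Inf {obj q | q s. feas q s}"
    and "{s \<in> S. V s = (INF s\<in>S. V s)} = {s. \<exists>q. feas q s \<and> obj q = Inf {obj q | q s. feas q s}}"
proof -
  show eq: "(INF s\<in>S. V s) = Inf {obj q | q s. feas q s}"
  proof (rule antisym)
    show "(INF s\<in>S. V s) \<le> Inf {obj q | q s. feas q s}"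
      using le by (auto intro!: Inf_greatest intro: INF_lower2)
    show "Inf {obj q | q s. feas q s} \<le> (INF s\<in>S. V s)"
    proof (rule INF_greatest)
      fix s assume "s \<in> S"
      then obtain q where "feas q s" "obj q \<le> V s" using att by blast
      then show "Inf {obj q | q s. feas q s} \<le> V s" by (auto intro: Inf_lower2)
    qed
  qed
  show "{s \<in> S. V s = (INF s\<in>S. V s)} = {s. \<exists>q. feas q s \<and> obj q = Inf {obj q | q s. feas q s}}"
  proof (intro set_eqI iffI)
    fix s assume "s \<in> {s \<in> S. V s = (INF s\<in>S. V s)}"
    then have s: "s \<in> S" "V s = (INF s\<in>S. V s)" by auto
    then obtain q where q: "feas q s" "obj q \<le> V s" using att by blast
    moreover have "Inf {obj q | q s. feas q s} \<le> obj q" using q(1) by (auto intro: Inf_lower)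
    ultimately show "s \<in> {s. \<exists>q. feas q s \<and> obj q = Inf {obj q | q s. feas q s}}"
      using s(2) eq by (auto intro!: antisym)
  next
    fix s assume "s \<in> {s. \<exists>q. feas q s \<and> obj q = Inf {obj q | q s. feas q s}}"
    then obtain q where q: "feas q s" "obj q = Inf {obj q | q s. feas q s}" by blast
    then have "V s \<le> (INF s\<in>S. V s)" "s \<in> S" using le[OF q(1)] eq by auto
    then show "s \<in> {s \<in> S. V s = (INF s\<in>S. V s)}" by (auto intro!: antisym INF_lower)
  qed
qed

theorem theorem6:
  fixes n N K :: nat and T C \<epsilon> :: real and c d uL uU :: vec and muh lamh :: "nat \<Rightarrow> vec"
  assumes "1 \<le> n" and "1 \<le> N" and "0 < T"
    and "\<forall>i\<in>{1..n}. 0 \<le> c i \<and> 0 \<le> d i" and "0 \<le> C"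
    and "\<forall>i\<in>{1..n-1}. d (i+1) - d i \<le> c (i+1)"
    and "\<forall>i\<in>{1..n}. 0 \<le> uL i \<and> uL i < uU i"
    and "K \<in> {1..n}"
    and "0 < \<epsilon>"
    and "\<forall>j\<in>{1..N}. (muh j, lamh j) \<in> Xi n K uL uU"
  shows "(Z_wns n T c d C uL uU K 1 N muh lamh \<epsilon> = Z_cop1 n T c d C uL uU K N muh lamh \<epsilon> \<and>
         wns_opt n T c d C uL uU K 1 N muh lamh \<epsilon> = cop1_opt n T c d C uL uU K N muh lamh \<epsilon>) \<and>
         (Z_wns n T c d C uL uU K 2 N muh lamh \<epsilon> = Z_cop2 n T c d C uL uU K N muh lamh \<epsilon> \<and>
         wns_opt n T c d C uL uU K 2 N muh lamh \<epsilon> = cop2_opt n T c d C uL uU K N muh lamh \<epsilon>)"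
proof -
  interpret no_show n K C c d uL uU
    using assms by unfold_locales (auto intro: less_imp_le)
  have data: "(muh j, lamh j) \<in> Xi n K uL uU" if "j \<in> {1..N}" for j using assms(10) that by blast
  have Svec: "s \<in> vecs n" if "s \<in> Sset n T" for s using that by (simp add: Sset_def)
  let ?V = "\<lambda>p s. wns_obj n T c d C uL uU K p N muh lamh \<epsilon> s"
  have feas1: "cop1_feas n T c d C uL uU K N muh lamh \<rho> \<beta> \<psi> \<phi> s \<longleftrightarrow> 0 \<le> \<rho> \<and> s \<in> Sset n T \<and>
    (\<forall>j\<in>{1..N}. cop_mat1 n (muh j) \<rho> s (\<beta> j) (\<lambda>i. \<psi> i j) (\<lambda>i. \<phi> i j) \<in>
      COP (5*n+1) (K1 n K uL uU C c d (muh j) (lamh j)))" for \<rho> \<beta> \<psi> \<phi> s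
    unfolding cop1_feas_def cop_mat1_def ..
  have feas2: "cop2_feas n T c d C uL uU K N muh lamh \<rho> \<beta> \<psi> s \<longleftrightarrow> 0 \<le> \<rho> \<and> s \<in> Sset n T \<and>
    (\<forall>j\<in>{1..N}. cop_mat2 n (muh j) (lamh j) \<rho> s (\<beta> j) (\<lambda>i. \<psi> i j) \<in>
      COP (3*n+1) (K2 n K uL uU C c d))" for \<rho> \<beta> \<psi> s
    unfolding cop2_feas_def cop_mat2_def ..
  let ?f1 = "\<lambda>(\<rho>, \<beta>, \<psi>, \<phi>) s. cop1_feas n T c d C uL uU K N muh lamh \<rho> \<beta> \<psi> \<phi> s"
    and ?o1 = "\<lambda>(\<rho>, \<beta>, \<psi> :: mat, \<phi> :: mat). ereal (cop1_obj N \<epsilon> \<rho> \<beta>)"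
  let ?f2 = "\<lambda>(\<rho>, \<beta>, \<psi>) s. cop2_feas n T c d C uL uU K N muh lamh \<rho> \<beta> \<psi> s"
    and ?o2 = "\<lambda>(\<rho>, \<beta>, \<psi> :: mat). ereal (cop2_obj N \<epsilon> \<rho> \<beta>)"
  have le1: "s \<in> Sset n T \<and> ?V 1 s \<le> ?o1 q" if "?f1 q s" for q s
  proof -
    obtain \<rho> \<beta> \<psi> \<phi> where q: "q = (\<rho>, \<beta>, \<psi>, \<phi>)" by (cases q) auto
    with that have f: "0 \<le> \<rho>" "s \<in> Sset n T"
      "\<And>j. j \<in> {1..N} \<Longrightarrow> cop_mat1 n (muh j) \<rho> s (\<beta> j) (\<lambda>i. \<psi> i j) (\<lambda>i. \<phi> i j) \<in>
        COP (5*n+1) (K1 n K uL uU C c d (muh j) (lamh j))" by (auto simp: feas1)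
    have "?V 1 s \<le> ereal (\<epsilon> ^ 1 * \<rho> + 1 / real N * (\<Sum>j=1..N. \<beta> j))"
    proof (rule wns_obj_le[OF Svec[OF f(2)] order_refl assms(2,9) f(1)])
      fix x j assume "x \<in> Xi n K uL uU" "j \<in> {1..N}"
      then show "gval n c d C s x - \<rho> * costp n 1 x (muh j, lamh j) \<le> \<beta> j"
        by (intro COP_imp_dual_bound1[OF Svec[OF f(2)] data _ f(3)])
    qed
    then show ?thesis using f(2) by (simp add: q cop1_obj_def)
  qed
  have le2: "s \<in> Sset n T \<and> ?V 2 s \<le> ?o2 q" if "?f2 q s" for q s
  proof -
    obtain \<rho> \<beta> \<psi> where q: "q = (\<rho>, \<beta>, \<psi>)" by (cases q) auto
    with that have f: "0 \<le> \<rho>" "s \<in> Sset n T"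
      "\<And>j. j \<in> {1..N} \<Longrightarrow> cop_mat2 n (muh j) (lamh j) \<rho> s (\<beta> j) (\<lambda>i. \<psi> i j) \<in>
        COP (3*n+1) (K2 n K uL uU C c d)" by (auto simp: feas2)
    have "?V 2 s \<le> ereal (\<epsilon> ^ 2 * \<rho> + 1 / real N * (\<Sum>j=1..N. \<beta> j))"
    proof (rule wns_obj_le[OF Svec[OF f(2)] one_le_numeral assms(2,9) f(1)])
      fix x j assume "x \<in> Xi n K uL uU" "j \<in> {1..N}"
      then show "gval n c d C s x - \<rho> * costp n 2 x (muh j, lamh j) \<le> \<beta> j"
        by (intro COP_imp_dual_bound2[OF Svec[OF f(2)] _ f(3)])
    qed
    then show ?thesis using f(2) by (simp add: q cop2_obj_def)
  qed
  have att1: "\<exists>q. ?f1 q s \<and> ?o1 q \<le> ?V 1 s" if s: "s \<in> Sset n T" for s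
  proof -
    obtain \<rho> \<beta> where \<rho>: "0 \<le> \<rho>"
      "\<And>x j. x \<in> Xi n K uL uU \<Longrightarrow> j \<in> {1..N} \<Longrightarrow>
        gval n c d C s x - \<rho> * costp n 1 x (muh j, lamh j) \<le> \<beta> j"
      "ereal (\<epsilon> ^ 1 * \<rho> + 1 / real N * (\<Sum>j=1..N. \<beta> j)) \<le> ?V 1 s"
      by (rule wns_obj_attained[OF Svec[OF s] order_refl assms(2,9) data]) blast+
    have "\<forall>j\<in>{1..N}. \<exists>L. cop_mat1 n (muh j) \<rho> s (\<beta> j) (\<lambda>_. L) (\<lambda>_. L) \<in>
        COP (5*n+1) (K1 n K uL uU C c d (muh j) (lamh j))"
      by (intro ballI dual_bound_imp_COP1 Svec s \<rho> data) assumption+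
    \<comment> \<open>One penalty constant per data point serves all coordinates: \<psi> and \<phi>
      are taken as \<open>L j\<close>, independent of \<open>i\<close>.\<close>
    then obtain L where "\<forall>j\<in>{1..N}. cop_mat1 n (muh j) \<rho> s (\<beta> j) (\<lambda>_. L j) (\<lambda>_. L j) \<in>
        COP (5*n+1) (K1 n K uL uU C c d (muh j) (lamh j))" by metis
    then show ?thesis using \<rho>(1,3) s
      by (intro exI[of _ "(\<rho>, \<beta>, \<lambda>_. L, \<lambda>_. L)"]) (simp add: feas1 cop1_obj_def)
  qed
  have att2: "\<exists>q. ?f2 q s \<and> ?o2 q \<le> ?V 2 s" if s: "s \<in> Sset n T" for s
  proof -
    obtain \<rho> \<beta> where \<rho>: "0 \<le> \<rho>"
      "\<And>x j. x \<in> Xi n K uL uU \<Longrightarrow> j \<in> {1..N} \<Longrightarrow>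
        gval n c d C s x - \<rho> * costp n 2 x (muh j, lamh j) \<le> \<beta> j"
      "ereal (\<epsilon> ^ 2 * \<rho> + 1 / real N * (\<Sum>j=1..N. \<beta> j)) \<le> ?V 2 s"
      by (rule wns_obj_attained[OF Svec[OF s] one_le_numeral assms(2,9) data]) blast+
    have "\<forall>j\<in>{1..N}. \<exists>L. cop_mat2 n (muh j) (lamh j) \<rho> s (\<beta> j) (\<lambda>_. L) \<in>
        COP (3*n+1) (K2 n K uL uU C c d)"
      by (intro ballI dual_bound_imp_COP2 Svec s \<rho> data) assumption+
    then obtain L where "\<forall>j\<in>{1..N}. cop_mat2 n (muh j) (lamh j) \<rho> s (\<beta> j) (\<lambda>_. L j) \<in>
        COP (3*n+1) (K2 n K uL uU C c d)" by metis
    then show ?thesis using \<rho>(1,3) s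
      by (intro exI[of _ "(\<rho>, \<beta>, \<lambda>_. L)"]) (simp add: feas2 cop2_obj_def)
  qed
  have sets1: "Z_cop1 n T c d C uL uU K N muh lamh \<epsilon> = Inf {?o1 q | q s. ?f1 q s}"
    unfolding Z_cop1_def by (simp add: split_paired_Ex)
  have sets2: "Z_cop2 n T c d C uL uU K N muh lamh \<epsilon> = Inf {?o2 q | q s. ?f2 q s}"
    unfolding Z_cop2_def by (simp add: split_paired_Ex)
  have opt1: "cop1_opt n T c d C uL uU K N muh lamh \<epsilon> = {s. \<exists>q. ?f1 q s \<and> ?o1 q = Inf {?o1 q | q s. ?f1 q s}}"
    unfolding cop1_opt_def sets1 by (simp add: split_paired_Ex)
  have opt2: "cop2_opt n T c d C uL uU K N muh lamh \<epsilon> = {s. \<exists>q. ?f2 q s \<and> ?o2 q = Inf {?o2 q | q s. ?f2 q s}}"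
    unfolding cop2_opt_def sets2 by (simp add: split_paired_Ex)
  show ?thesis
    unfolding wns_opt_def Z_wns_def sets1 sets2 opt1 opt2
    by (intro conjI optima_coincide[of ?f1 "Sset n T" "?V 1" ?o1, OF le1 att1]
        optima_coincide[of ?f2 "Sset n T" "?V 2" ?o2, OF le2 att2])
qed

end
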